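(* Let $q$ be a prime power, $I=(n_1,\dots,n_l)$ a composition of $n$, $m_0=0$, $m_k=\sum_{i=1}^k n_i$, and $\mathcal{P}=\mathbb{F}_q[x_1,\dots,x_n]$. The monomial $$\prod_{i=1}^{l}\prod_{j=1}^{n_i}x_{m_{i-1}+j}^{q^{m_i}-q^{m_i-j}-1}$$ generates a block basis for $\mathcal{P}_{\operatorname{GL}_I}$.
   Context: $\operatorname{GL}_I\le\operatorname{GL}_n(q)$ is the parabolic subgroup of all invertible block upper triangular matrices with diagonal blocks in $\operatorname{GL}_{n_1}(q),\dots,\operatorname{GL}_{n_l}(q)$ (arbitrary entries above the diagonal blocks). $\operatorname{GL}_n(q)$ acts on $V=\langle x_1,\dots,x_n\rangle_{\mathbb{F}_q}=\mathbb{F}_q^n$ naturally, i.e. $g\cdot x_k=\sum_i g_{ik}x_i$, and on $\mathcal{P}=S^\bullet(V)$ by algebra automorphisms. For a subgroup $G\le\operatorname{GL}_n(q)$, $\mathcal{P}_G=\mathcal{P}/\mathcal{I}$ where $\mathcal{I}$ is the ideal generated by the homogeneous elements of $\mathcal{P}^G$ of positive degree. A monomial $f$ generates a block basis for $\mathcal{P}_G$ if the set of all its monomial factors (monic monomial divisors) projects to an $\mathbb{F}_q$-basis of $\mathcal{P}/\mathcal{I}$. *)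

theory Defs
  imports "HOL-Algebra.QuotRing" "HOL-Algebra.Divisibility" "HOL-Library.Poly_Mapping"
    "Jordan_Normal_Form.VS_Connect"
begin

text \<open>
  A polynomial is a finitely supported map from exponent vectors to coefficients. Indices are
  0-based: the variables of $\mathbb{F}[x_1,\dots,x_n]$ are \<open>Var 0, \<dots>, Var (n - 1)\<close>, matching
  the 0-based matrix entries of \<^typ>\<open>'a mat\<close>.
\<close>

type_synonym 'a mpoly = "(nat \<Rightarrow>\<^sub>0 nat) \<Rightarrow>\<^sub>0 'a"

definition Const :: "'a::zero \<Rightarrow> 'a mpoly" where
  "Const c = Poly_Mapping.single 0 c"

definition Var :: "nat \<Rightarrow> 'a::zero_neq_one mpoly" where
  "Var k = Poly_Mapping.single (Poly_Mapping.single k 1) 1"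

definition poly_ring :: "nat \<Rightarrow> 'a::comm_ring_1 mpoly ring" where
  "poly_ring n =
     class_ring\<lparr>carrier := {p. \<forall>m\<in>Poly_Mapping.keys p. Poly_Mapping.keys m \<subseteq> {..<n}}\<rparr>"

definition monomials :: "nat \<Rightarrow> 'a::comm_ring_1 mpoly set" where
  "monomials n = {Poly_Mapping.single m 1 | m. Poly_Mapping.keys m \<subseteq> {..<n}}"

definition mon_deg :: "(nat \<Rightarrow>\<^sub>0 nat) \<Rightarrow> nat" where
  "mon_deg m = (\<Sum>k\<in>Poly_Mapping.keys m. Poly_Mapping.lookup m k)"

definition homogeneous :: "nat \<Rightarrow> 'a::zero mpoly \<Rightarrow> bool" where
  "homogeneous d p \<longleftrightarrow> (\<forall>m\<in>Poly_Mapping.keys p. mon_deg m = d)"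

definition GL :: "nat \<Rightarrow> 'a::field mat set" where
  "GL n = {g \<in> carrier_mat n n. invertible_mat g}"

text \<open>The algebra endomorphism extending $g \cdot x_k = \sum_i g_{ik} x_i$.\<close>

definition act :: "nat \<Rightarrow> 'a::comm_ring_1 mat \<Rightarrow> 'a mpoly \<Rightarrow> 'a mpoly" where
  "act n g p = (\<Sum>m\<in>Poly_Mapping.keys p. Const (Poly_Mapping.lookup p m) *
     (\<Prod>k\<in>Poly_Mapping.keys m.
        (\<Sum>i<n. Const (g $$ (i, k)) * Var i) ^ Poly_Mapping.lookup m k))"

definition invariants :: "nat \<Rightarrow> 'a::comm_ring_1 mat set \<Rightarrow> 'a mpoly set" where
  "invariants n G = {p \<in> carrier (poly_ring n). \<forall>g\<in>G. act n g p = p}"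

definition coinv_ideal :: "nat \<Rightarrow> 'a::comm_ring_1 mat set \<Rightarrow> 'a mpoly set" where
  "coinv_ideal n G = Idl\<^bsub>poly_ring n\<^esub> {p \<in> invariants n G. \<exists>d>0. homogeneous d p}"

text \<open>
  The quotient ring, with scalars acting through the structure map
  \<open>c \<mapsto> Const c + \<I>\<close>.
\<close>

definition coinvariants ::
    "nat \<Rightarrow> 'a::comm_ring_1 mat set \<Rightarrow> ('a, 'a mpoly set) module" where
  "coinvariants n G =
     (let J = coinv_ideal n G; Q = poly_ring n Quot J in
      \<lparr>carrier = carrier Q, monoid.mult = monoid.mult Q, one = one Q, zero = zero Q, add = add Q,
       module.smult = (\<lambda>c x. (J +>\<^bsub>poly_ring n\<^esub> Const c) \<otimes>\<^bsub>Q\<^esub> x)\<rparr>)"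

definition coinv_proj :: "nat \<Rightarrow> 'a::comm_ring_1 mat set \<Rightarrow> 'a mpoly \<Rightarrow> 'a mpoly set" where
  "coinv_proj n G p = coinv_ideal n G +>\<^bsub>poly_ring n\<^esub> p"

definition monomial_factors :: "nat \<Rightarrow> 'a::comm_ring_1 mpoly \<Rightarrow> 'a mpoly set" where
  "monomial_factors n f = {b \<in> monomials n. b divides\<^bsub>poly_ring n\<^esub> f}"

text \<open>
  Injectivity is required separately, so that distinct monomial factors give distinct members
  of the basis.
\<close>

definition generates_block_basis :: "nat \<Rightarrow> 'a::field mat set \<Rightarrow> 'a mpoly \<Rightarrow> bool" where
  "generates_block_basis n G f \<longleftrightarrow> f \<in> monomials n \<and>
     inj_on (coinv_proj n G) (monomial_factors n f) \<and>
     vectorspace.basis class_ring (coinvariants n G) (coinv_proj n G ` monomial_factors n f)"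

definition part_sum :: "nat list \<Rightarrow> nat \<Rightarrow> nat" where
  "part_sum I k = sum_list (take k I)"

text \<open>
  Rows and columns \<open>part_sum I k, \<dots>, part_sum I (k + 1) - 1\<close> form the block with 0-based
  number \<open>k\<close>.
\<close>

definition GL_parabolic :: "nat list \<Rightarrow> 'a::field mat set" where
  "GL_parabolic I = {g \<in> GL (sum_list I).
     (\<forall>k<length I. \<forall>r<sum_list I. \<forall>c<sum_list I.
        c < part_sum I k \<and> part_sum I k \<le> r \<longrightarrow> g $$ (r, c) = 0) \<and>
     (\<forall>k<length I.
        mat (I ! k) (I ! k) (\<lambda>(r, c). g $$ (part_sum I k + r, part_sum I k + c)) \<in> GL (I ! k))}"

text \<open>
  The constants \<^const>\<open>vectorspace.basis\<close> and \<^const>\<open>coinvariants\<close> have their intended meaning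
  because the quotient is a vector space.
\<close>

lemma carrier_poly_ring_add:
  assumes "p \<in> carrier (poly_ring n)" "r \<in> carrier (poly_ring n)"
  shows "p + r \<in> carrier (poly_ring n)"
  using assms Poly_Mapping.keys_add[of p r] by (fastforce simp: poly_ring_def)

lemma carrier_poly_ring_mult:
  assumes "p \<in> carrier (poly_ring n)" "r \<in> carrier (poly_ring n)"
  shows "p * r \<in> carrier (poly_ring n)"
proof -
  have "Poly_Mapping.keys m \<subseteq> {..<n}" if m: "m \<in> Poly_Mapping.keys (p * r)" for m
  proof -
    obtain a b where "m = a + b" "a \<in> Poly_Mapping.keys p" "b \<in> Poly_Mapping.keys r"
      using m Poly_Mapping.keys_mult[of p r] by blast
    then show ?thesis
      using assms Poly_Mapping.keys_add[of a b] by (fastforce simp: poly_ring_def)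
  qed
  then show ?thesis by (simp add: poly_ring_def)
qed

lemma poly_ring_ops [simp]:
  "monoid.mult (poly_ring n) = (*)" "one (poly_ring n) = 1"
  "zero (poly_ring n) = 0" "add (poly_ring n) = (+)"
  by (simp_all add: poly_ring_def)

lemma carrier_poly_ring_0_1:
  "0 \<in> carrier (poly_ring n)" "1 \<in> carrier (poly_ring n)"
  by (simp_all add: poly_ring_def)

lemma cring_poly_ring: "cring (poly_ring n :: 'a::comm_ring_1 mpoly ring)"
proof (rule cringI)
  show "abelian_group (poly_ring n :: 'a mpoly ring)"
  proof (rule abelian_groupI)
    fix x :: "'a mpoly" assume x: "x \<in> carrier (poly_ring n)"
    then have "- x \<in> carrier (poly_ring n)" by (simp add: poly_ring_def)
    then show "\<exists>y\<in>carrier (poly_ring n). y \<oplus>\<^bsub>poly_ring n\<^esub> x = \<zero>\<^bsub>poly_ring n\<^esub>"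
      by (intro bexI[of _ "- x"]) auto
  qed (auto simp: carrier_poly_ring_add carrier_poly_ring_0_1 algebra_simps)
  show "comm_monoid (poly_ring n :: 'a mpoly ring)"
    by (rule comm_monoidI)
      (auto simp: carrier_poly_ring_mult carrier_poly_ring_0_1 algebra_simps)
qed (auto simp: algebra_simps)

lemma ideal_coinv_ideal: "ideal (coinv_ideal n G) (poly_ring n)"
proof -
  interpret cring "poly_ring n" by (rule cring_poly_ring)
  show ?thesis unfolding coinv_ideal_def
    by (rule genideal_ideal) (auto simp: invariants_def)
qed

lemma vectorspace_coinvariants:
  "vectorspace (class_ring :: 'a::field ring) (coinvariants n G)"
proof -
  let ?P = "poly_ring n :: 'a mpoly ring"
  let ?J = "coinv_ideal n G"
  let ?Q = "?P Quot ?J"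
  let ?V = "coinvariants n G"
  interpret P: cring ?P by (rule cring_poly_ring)
  interpret J: ideal ?J ?P by (rule ideal_coinv_ideal)
  interpret Q: cring ?Q by (rule J.quotient_is_cring[OF cring_poly_ring])
  interpret h: ring_hom_ring ?P ?Q "(+>\<^bsub>?P\<^esub>) ?J" by (rule J.rcos_ring_hom_ring)
  have V: "carrier ?V = carrier ?Q" "add ?V = add ?Q" "zero ?V = zero ?Q" "monoid.mult ?V = monoid.mult ?Q"
    "one ?V = one ?Q"
    "module.smult ?V = (\<lambda>c x. (?J +>\<^bsub>?P\<^esub> Const c) \<otimes>\<^bsub>?Q\<^esub> x)"
    by (simp_all add: coinvariants_def Let_def)
  have C: "Const c \<in> carrier ?P" for c
    by (simp add: poly_ring_def Const_def)
  let ?h = "\<lambda>c. ?J +>\<^bsub>?P\<^esub> Const c"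
  have hC: "?h c \<in> carrier ?Q" for c
    by (rule h.hom_closed[OF C])
  have h1: "?h 1 = \<one>\<^bsub>?Q\<^esub>"
    using h.hom_one by (simp add: Const_def)
  have hadd: "?h (a + b) = ?h a \<oplus>\<^bsub>?Q\<^esub> ?h b" for a b
    using h.hom_add[OF C C, of a b] by (simp add: Const_def single_add)
  have hmult: "?h (a * b) = ?h a \<otimes>\<^bsub>?Q\<^esub> ?h b" for a b
    using h.hom_mult[OF C C, of a b] by (simp add: Const_def mult_single)
  have "abelian_group ?V"
  proof (rule abelian_groupI)
    fix x assume "x \<in> carrier ?V"
    then show "\<exists>y\<in>carrier ?V. y \<oplus>\<^bsub>?V\<^esub> x = \<zero>\<^bsub>?V\<^esub>"
      by (intro bexI[of _ "\<ominus>\<^bsub>?Q\<^esub> x"]) (auto simp: V Q.l_neg)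
  qed (simp_all add: V Q.a_ac)
  moreover have "module_axioms (class_ring :: 'a ring) ?V"
    by (rule module_axioms.intro)
      (simp_all add: V hC hadd hmult h1 Q.l_distr Q.r_distr Q.m_assoc)
  ultimately show ?thesis
    by (intro vectorspace.intro Module.module.intro class_field class_cring.cring_axioms)
qed

end

theory Submission
  imports Defs "Jordan_Normal_Form.Char_Poly"
begin

text \<open>
  Let $S$ be the ring of invariants and $V_m = \langle x_1, \dots, x_m\rangle$. Run through the blocks
  in order, and through each block from the last variable to the first. If $W$ is the span of the $s$
  variables already treated and $x$ is the next one, in a block ending at $m$, then $x$ is a root of the
  monic polynomial $\prod_{v \in V_m \setminus W} (X - v)$ of degree $q^m - q^s$. Its coefficients lie
  in the ring generated by $S$ and the treated variables, because it is the quotient of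
  $\prod_{v \in V_m} (X - v)$, which the group fixes, by the monic polynomial $\prod_{v \in W} (X - v)$.
  Hence the factors of the given monomial generate the polynomial ring as an $S$-module.

  There are no more factors than group elements, as one sees by choosing the columns of a matrix
  one after the other. By Dedekind's independence of characters a generating family of at most as many
  elements as there are automorphisms fixing $S$ is free. Freeness over $S$ yields linear independence
  modulo the ideal, by comparing constant terms of the coefficients; in particular neither Dickson's
  theorem nor any other description of $S$ is needed.
\<close>

section \<open>Monic polynomials over a subring\<close>

text \<open>Why the two counts fit: step \<open>s\<close> contributes the degree q^m - q^s, the
  number of forms in V_m outside W. A column with index k, in a block of indices lo, ..., m - 1, can
  be chosen in q^m - q^k ways: of the q^m vectors supported in the first m rows, at most q^lo * q^(k
  - lo) have a block part that depends on the earlier columns of the block. The factors for s and k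
  of equal value coincide, so the number of monomial factors is at most the order of the group. V_m
  has to end at a block end, because in general only those spans are stable under the group. W may
  stop inside a block, because its elements have already been adjoined. Reversing each block only
  decides which variable receives which degree: the j-th variable of block i is preceded by m_i - j
  treated ones, whence the exponent in the theorem. Passing to the quotient requires control of the
  ideal through coefficients. Since the monomials generate over S, the combinations whose
  coefficients lie in S and have no constant term are closed under multiplication by every
  polynomial, and so they contain the ideal.\<close>

definition unital_subring :: "'a::comm_ring_1 set \<Rightarrow> bool" where
  "unital_subring R \<longleftrightarrow> 1 \<in> R \<and> (\<forall>x\<in>R. \<forall>y\<in>R. x - y \<in> R \<and> x * y \<in> R)"

lemma unital_subringD:
  assumes "unital_subring R"
  shows "1 \<in> R" "0 \<in> R" "x \<in> R \<Longrightarrow> y \<in> R \<Longrightarrow> x - y \<in> R" "x \<in> R \<Longrightarrow> y \<in> R \<Longrightarrow> x * y \<in> R"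
    "x \<in> R \<Longrightarrow> - x \<in> R" "x \<in> R \<Longrightarrow> y \<in> R \<Longrightarrow> x + y \<in> R"
proof -
  note R = assms[unfolded unital_subring_def]
  show "1 \<in> R" "x \<in> R \<Longrightarrow> y \<in> R \<Longrightarrow> x - y \<in> R" "x \<in> R \<Longrightarrow> y \<in> R \<Longrightarrow> x * y \<in> R"
    using R by auto
  show 0: "0 \<in> R" using R by (metis diff_self)
  show neg: "- x \<in> R" if "x \<in> R" for x using R 0 that by (metis diff_0)
  show "x \<in> R \<Longrightarrow> y \<in> R \<Longrightarrow> x + y \<in> R" using R neg by (metis diff_minus_eq_add)
qed

lemma unital_subring_sum:
  assumes "unital_subring R" "\<And>i. i \<in> A \<Longrightarrow> f i \<in> R"
  shows "sum f A \<in> R"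
  using assms(2) by (induction A rule: infinite_finite_induct) (auto intro: unital_subringD[OF assms(1)])

lemma unital_subring_prod:
  assumes "unital_subring R" "\<And>i. i \<in> A \<Longrightarrow> f i \<in> R"
  shows "prod f A \<in> R"
  using assms(2) by (induction A rule: infinite_finite_induct) (auto intro: unital_subringD[OF assms(1)])

lemma unital_subring_power:
  assumes "unital_subring R" "x \<in> R"
  shows "x ^ k \<in> R"
  using assms(2) by (induction k) (auto intro: unital_subringD[OF assms(1)])

text \<open>Subrings are sets inside one ring type, so a polynomial over a subring is a polynomial
  over the whole ring with restricted coefficients. Evaluation, degree and factorisation then need
  no change of type along the tower.\<close>

definition polys_over :: "'a::comm_ring_1 set \<Rightarrow> 'a poly set" where
  "polys_over R = {p. \<forall>i. coeff p i \<in> R}"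

lemma unital_subring_polys_over:
  assumes "unital_subring R"
  shows "unital_subring (polys_over R)"
  using unital_subringD[OF assms]
  by (auto simp: unital_subring_def polys_over_def coeff_mult coeff_1 intro!: unital_subring_sum[OF assms])

lemma linear_polys_over:
  assumes "unital_subring R" "v \<in> R"
  shows "[:- v, 1:] \<in> polys_over R"
  using unital_subringD[OF assms(1)] assms(2)
  by (auto simp: polys_over_def coeff_pCons split: nat.splits)

text \<open>The coefficient of \<open>d * p\<close> at \<open>i + degree d\<close> contains
  \<open>coeff p i\<close> with factor 1; its other terms involve only coefficients of
  \<open>p\<close> at higher indices. Hence the coefficients of \<open>p\<close> can be solved for
  from the top down.\<close>

lemma monic_quotient_polys_over:
  assumes R: "unital_subring R" and d: "d \<in> polys_over R" "lead_coeff d = 1"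
    and p: "d * p \<in> polys_over R"
  shows "p \<in> polys_over R"
proof -
  have "coeff p i \<in> R" for i
  \<comment> \<open>Downward induction on \<open>i\<close>; indices above the degree are the base
    case.\<close>
  proof (induction "Suc (degree p) - i" arbitrary: i rule: less_induct)
    case less
    show ?case
    proof (cases "i > degree p")
      case True
      then show ?thesis by (simp add: coeff_eq_0 unital_subringD[OF R])
    next
      case False
      let ?D = "degree d"
      have split: "{..i + ?D} = insert ?D ({..i + ?D} - {?D})" by auto
      have "coeff (d * p) (i + ?D) = (\<Sum>j\<le>i + ?D. coeff d j * coeff p (i + ?D - j))"
        by (simp add: coeff_mult)
      also have "\<dots> = coeff p i + (\<Sum>j\<in>{..i + ?D} - {?D}. coeff d j * coeff p (i + ?D - j))"
        by (subst split, subst sum.insert) (use d in auto)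
      finally have "coeff p i = coeff (d * p) (i + ?D) -
        (\<Sum>j\<in>{..i + ?D} - {?D}. coeff d j * coeff p (i + ?D - j))" by simp
      also have "\<dots> \<in> R"
      proof (intro unital_subringD(3)[OF R] unital_subring_sum[OF R])
        fix j assume j: "j \<in> {..i + ?D} - {?D}"
        show "coeff d j * coeff p (i + ?D - j) \<in> R"
        proof (cases "j < ?D")
          case True
          then have "coeff p (i + ?D - j) \<in> R" using False by (intro less) auto
          then show ?thesis using d unital_subringD(4)[OF R] by (auto simp: polys_over_def)
        next
          case False
          then have "coeff d j = 0" using j by (intro coeff_eq_0) auto
          then show ?thesis by (simp add: unital_subringD[OF R])
        qed
      qed (use p in \<open>auto simp: polys_over_def\<close>)
      finally show ?thesis .
    qed
  qed
  then show ?thesis by (simp add: polys_over_def)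
qed

text \<open>Division with remainder stays inside \<open>R\<close> because the leading coefficient 1
  never has to be inverted, and subtracting multiples of \<open>Q\<close> does not change the value
  at a root of \<open>Q\<close>.\<close>

lemma reduce_mod_monic:
  assumes R: "unital_subring R" and Q: "Q \<in> polys_over R" "lead_coeff Q = 1" "poly Q x = 0"
    and p: "p \<in> polys_over R"
  shows "\<exists>r\<in>polys_over R. (\<forall>i\<ge>degree Q. coeff r i = 0) \<and> poly r x = poly p x"
  using p
proof (induction "degree p" arbitrary: p rule: less_induct)
  case less
  note P = unital_subring_polys_over[OF R]
  show ?case
  proof (cases "degree p < degree Q \<or> p = 0")
    case True
    then show ?thesis using less(2) by (intro bexI[of _ p]) (auto simp: coeff_eq_0)
  next
    case False
    define p' where "p' = p - monom (lead_coeff p) (degree p - degree Q) * Q"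
    have "monom (lead_coeff p) (degree p - degree Q) \<in> polys_over R"
      using less(2) unital_subringD(2)[OF R] by (auto simp: polys_over_def)
    then have p': "p' \<in> polys_over R"
      unfolding p'_def using less(2) Q by (intro unital_subringD[OF P]) auto
    have ev: "poly p' x = poly p x" by (simp add: p'_def Q)
    have "degree Q > 0"
    proof (rule ccontr)
      assume "\<not> degree Q > 0"
      then obtain c where "Q = [:c:]" by (metis degree_eq_zeroE gr0I)
      then show False using Q by auto
    qed
    have "coeff p' i = 0" if i: "i \<ge> degree p" for i
    proof (cases "i = degree p")
      case True
      then show ?thesis using False Q by (simp add: p'_def coeff_monom_mult)
    next
      case False
      then have "i > degree p" using i by simp
      moreover have "coeff Q (i - (degree p - degree Q)) = 0" if "degree p \<ge> degree Q"
        using \<open>i > degree p\<close> that by (intro coeff_eq_0) auto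
      ultimately show ?thesis using \<open>\<not> (degree p < degree Q \<or> p = 0)\<close>
        by (simp add: p'_def coeff_monom_mult coeff_eq_0)
    qed
    then have "degree p' < degree p \<or> p' = 0"
      by (metis leading_coeff_0_iff linorder_not_le)
    then show ?thesis
    proof
      assume "degree p' < degree p"
      from less(1)[OF this p'] show ?thesis by (simp add: ev)
    next
      assume "p' = 0"
      then show ?thesis using ev p' by (intro bexI[of _ 0]) auto
    qed
  qed
qed

definition adjoin :: "'a::comm_ring_1 set \<Rightarrow> 'a \<Rightarrow> 'a set" where
  "adjoin R x = (\<lambda>p. poly p x) ` polys_over R"

lemma unital_subring_adjoin:
  assumes "unital_subring R"
  shows "unital_subring (adjoin R x)"
proof -
  note P = unital_subringD[OF unital_subring_polys_over[OF assms]]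
  show ?thesis unfolding unital_subring_def adjoin_def
  proof (intro conjI ballI)
    show "1 \<in> (\<lambda>p. poly p x) ` polys_over R" by (intro image_eqI[OF _ P(1)]) auto
  next
    fix a b assume "a \<in> (\<lambda>p. poly p x) ` polys_over R" "b \<in> (\<lambda>p. poly p x) ` polys_over R"
    then obtain p r where pr: "p \<in> polys_over R" "r \<in> polys_over R" "a = poly p x" "b = poly r x" by auto
    show "a - b \<in> (\<lambda>p. poly p x) ` polys_over R"
      by (intro image_eqI[OF _ P(3)[OF pr(1,2)]]) (auto simp: pr)
    show "a * b \<in> (\<lambda>p. poly p x) ` polys_over R"
      by (intro image_eqI[OF _ P(4)[OF pr(1,2)]]) (auto simp: pr)
  qed
qed

lemma subset_adjoin:
  assumes "unital_subring R"
  shows "R \<subseteq> adjoin R x" "x \<in> adjoin R x"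
proof -
  show "R \<subseteq> adjoin R x"
  proof
    fix a assume "a \<in> R"
    then have "[:a:] \<in> polys_over R"
      using unital_subringD[OF assms] by (auto simp: polys_over_def coeff_pCons split: nat.splits)
    then show "a \<in> adjoin R x" unfolding adjoin_def by (intro image_eqI) auto
  qed
  have "[:0, 1:] \<in> polys_over R"
    using unital_subringD[OF assms] by (auto simp: polys_over_def coeff_pCons split: nat.splits)
  then show "x \<in> adjoin R x" unfolding adjoin_def by (intro image_eqI) auto
qed

text \<open>The source of the exponent bounds: adjoining a root of a monic polynomial costs only the
  powers below its degree.\<close>

lemma adjoin_root_monic:
  assumes R: "unital_subring R" and Q: "Q \<in> polys_over R" "lead_coeff Q = 1" "poly Q x = 0"
    and y: "y \<in> adjoin R x"
  shows "\<exists>r. (\<forall>i<degree Q. r i \<in> R) \<and> y = (\<Sum>i<degree Q. r i * x ^ i)"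
proof -
  obtain p where p: "p \<in> polys_over R" "y = poly p x" using y by (auto simp: adjoin_def)
  obtain r where r: "r \<in> polys_over R" "\<forall>i\<ge>degree Q. coeff r i = 0" "poly r x = y"
    using reduce_mod_monic[OF R Q p(1)] p(2) by auto
  have "y = (\<Sum>i\<le>degree r. coeff r i * x ^ i)" by (simp add: r(3)[symmetric] poly_altdef)
  also have "\<dots> = (\<Sum>i\<in>{..degree r} \<union> {..<degree Q}. coeff r i * x ^ i)"
    by (rule sum.mono_neutral_left) (auto simp: coeff_eq_0)
  also have "\<dots> = (\<Sum>i<degree Q. coeff r i * x ^ i)"
    by (rule sum.mono_neutral_right) (use r in auto)
  finally show ?thesis using r(1) by (intro exI[of _ "coeff r"]) (auto simp: polys_over_def)
qed

section \<open>The action on polynomials\<close>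

lemma Const_simps [simp]:
  "Const 0 = 0" "Const 1 = (1 :: 'a::comm_ring_1 mpoly)"
  "Const (a + b :: 'a) = Const a + Const b" "Const (a * b :: 'a) = Const a * Const b"
  "Const (- a :: 'a) = - Const a"
  by (simp_all add: Const_def single_add mult_single single_uminus)

lemma Const_sum: "Const (sum f A :: 'a::comm_ring_1) = (\<Sum>x\<in>A. Const (f x))"
  by (induction A rule: infinite_finite_induct) auto

lemma poly_mapping_sum_single:
  assumes "finite A" "Poly_Mapping.keys p \<subseteq> A"
  shows "(\<Sum>m\<in>A. Poly_Mapping.single m (Poly_Mapping.lookup p m)) = p"
  using assms
  by (intro poly_mapping_eqI)
    (auto simp: lookup_sum lookup_single when_def in_keys_iff)

text \<open>Substitution into a monomial. With \<open>Var\<close> for \<open>L\<close> it returns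
  the monomial itself; with the image forms of a matrix it gives the action.\<close>

definition monom_value :: "(nat \<Rightarrow> 'b::comm_monoid_mult) \<Rightarrow> (nat \<Rightarrow>\<^sub>0 nat) \<Rightarrow> 'b" where
  "monom_value L m = (\<Prod>k\<in>Poly_Mapping.keys m. L k ^ Poly_Mapping.lookup m k)"

lemma monom_value_superset:
  assumes "finite A" "Poly_Mapping.keys m \<subseteq> A"
  shows "monom_value L m = (\<Prod>k\<in>A. L k ^ Poly_Mapping.lookup m k)"
  unfolding monom_value_def
  by (rule prod.mono_neutral_left) (use assms in \<open>auto simp: in_keys_iff\<close>)

lemma monom_value_0 [simp]: "monom_value L 0 = 1"
  by (simp add: monom_value_def)

lemma monom_value_add: "monom_value L (m + m') = monom_value L m * monom_value L m'"
proof -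
  let ?A = "Poly_Mapping.keys m \<union> Poly_Mapping.keys m'"
  have "monom_value L (m + m') = (\<Prod>k\<in>?A. L k ^ Poly_Mapping.lookup (m + m') k)"
    by (rule monom_value_superset) (auto simp: Poly_Mapping.keys_add)
  then show ?thesis
    by (simp add: monom_value_superset[of ?A m] monom_value_superset[of ?A m']
        lookup_add power_add prod.distrib)
qed

lemma monom_value_single: "monom_value L (Poly_Mapping.single k e) = L k ^ e"
  by (simp add: monom_value_def)

lemma monom_value_Var: "monom_value Var m = (Poly_Mapping.single m 1 :: 'a::comm_ring_1 mpoly)"
proof -
  have pow: "(Var k :: 'a mpoly) ^ e = Poly_Mapping.single (Poly_Mapping.single k e) 1" for k e
    by (induction e) (auto simp: Var_def mult_single single_add[symmetric])
  have "(\<Prod>k\<in>A. Poly_Mapping.single (f k) 1 :: 'a mpoly) = Poly_Mapping.single (sum f A) 1"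
    for A :: "nat set" and f :: "nat \<Rightarrow> nat \<Rightarrow>\<^sub>0 nat"
    by (induction A rule: infinite_finite_induct) (auto simp: mult_single)
  then show ?thesis
    by (simp add: monom_value_def pow poly_mapping_sum_single)
qed

definition lin_form :: "nat \<Rightarrow> (nat \<Rightarrow> 'a::comm_ring_1) \<Rightarrow> 'a mpoly" where
  "lin_form n c = (\<Sum>i<n. Const (c i) * Var i)"

text \<open>The keys of a sum can shrink by cancellation. A common index set for \<open>p\<close>,
  \<open>r\<close> and \<open>p + r\<close> makes additivity a termwise statement.\<close>

lemma act_superset:
  assumes "finite A" "Poly_Mapping.keys p \<subseteq> A"
  shows "act n g p = (\<Sum>m\<in>A. Const (Poly_Mapping.lookup p m) *
    monom_value (\<lambda>k. lin_form n (\<lambda>i. g $$ (i, k))) m)"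
  unfolding act_def monom_value_def lin_form_def
  by (rule sum.mono_neutral_left) (use assms in \<open>auto simp: in_keys_iff\<close>)

lemma act_single:
  "act n g (Poly_Mapping.single m c) = Const c * monom_value (\<lambda>k. lin_form n (\<lambda>i. g $$ (i, k))) m"
  by (subst act_superset[of "{m}"]) auto

lemma act_add: "act n g (p + r) = act n g p + act n g r"
  using Poly_Mapping.keys_add[of p r]
  by (simp add: act_superset[of "Poly_Mapping.keys p \<union> Poly_Mapping.keys r"] lookup_add
      distrib_right sum.distrib)

lemma act_0 [simp]: "act n g 0 = 0"
  by (simp add: act_def)

lemma act_sum: "act n g (sum f A) = (\<Sum>x\<in>A. act n g (f x))"
  by (induction A rule: infinite_finite_induct) (auto simp: act_add)

lemma act_mult: "act n g (p * r) = act n g p * act n g r"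
proof -
  let ?s = "\<lambda>p m. Poly_Mapping.single m (Poly_Mapping.lookup p m)"
  let ?P = "Poly_Mapping.keys p" and ?R = "Poly_Mapping.keys r"
  have p: "p = sum (?s p) ?P" and r: "r = sum (?s r) ?R"
    by (simp_all add: poly_mapping_sum_single)
  have "act n g (sum (?s p) ?P * sum (?s r) ?R) = act n g (sum (?s p) ?P) * act n g (sum (?s r) ?R)"
    by (simp add: sum_product act_sum mult_single act_single monom_value_add algebra_simps)
  then show ?thesis using p r by simp
qed

lemma act_Const [simp]: "act n g (Const c) = Const c"
  unfolding Const_def by (subst act_single) (simp add: Const_def)

lemma act_1 [simp]: "act n g 1 = 1"
  using act_Const[of n g 1] by simp

lemma act_Var: "act n g (Var k) = lin_form n (\<lambda>i. g $$ (i, k))"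
  unfolding Var_def by (subst act_single) (simp add: monom_value_single)

lemma comm_ring_hom_act: "comm_ring_hom (act n g)"
  by unfold_locales (auto simp: act_add act_mult)

lemma act_minus: "act n g (p - r) = act n g p - act n g r"
  using act_add[of n g "p - r" r] by simp

lemma act_lin_form:
  "act n g (lin_form n c) = lin_form n (\<lambda>i. \<Sum>k<n. g $$ (i, k) * c k)"
proof -
  have "act n g (lin_form n c) = (\<Sum>k<n. \<Sum>i<n. Const (c k) * (Const (g $$ (i, k)) * Var i))"
    by (simp add: lin_form_def[of n c] act_sum act_mult act_Var, simp add: lin_form_def sum_distrib_left)
  also have "\<dots> = (\<Sum>i<n. \<Sum>k<n. Const (g $$ (i, k) * c k) * Var i)"
    by (subst sum.swap) (simp add: algebra_simps)
  finally show ?thesis by (simp add: lin_form_def Const_sum sum_distrib_right)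
qed

lemma lookup_lin_form:
  assumes "i < n"
  shows "Poly_Mapping.lookup (lin_form n c) (Poly_Mapping.single i 1) = c i"
proof -
  have *: "Const (c k) * Var k = Poly_Mapping.single (Poly_Mapping.single k 1) (c k)" for k
    by (simp add: Const_def Var_def mult_single)
  have inj: "Poly_Mapping.single k (1::nat) = Poly_Mapping.single i 1 \<longleftrightarrow> k = i" for k
    by (metis lookup_single_eq lookup_single_not_eq zero_neq_one)
  have "Poly_Mapping.lookup (lin_form n c) (Poly_Mapping.single i 1) = (\<Sum>k<n. if k = i then c k else 0)"
    unfolding lin_form_def lookup_sum * lookup_single when_def inj by simp
  then show ?thesis using assms by simp
qed

lemma lin_form_eq_iff: "lin_form n c = lin_form n d \<longleftrightarrow> (\<forall>i<n. c i = d i)"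
proof
  assume "lin_form n c = lin_form n d"
  then show "\<forall>i<n. c i = d i" by (metis lookup_lin_form)
qed (simp add: lin_form_def)

lemma unital_subring_carrier: "unital_subring (carrier (poly_ring n :: 'a::comm_ring_1 mpoly ring))"
proof -
  have "x - y \<in> carrier (poly_ring n)"
    if "x \<in> carrier (poly_ring n)" "y \<in> carrier (poly_ring n)" for x y :: "'a mpoly"
  proof -
    have "- y \<in> carrier (poly_ring n)" using that(2) by (simp add: poly_ring_def)
    from carrier_poly_ring_add[OF that(1) this] show ?thesis by simp
  qed
  then show ?thesis
    unfolding unital_subring_def by (auto simp: carrier_poly_ring_0_1 carrier_poly_ring_mult)
qed

lemma Const_in_carrier [simp]: "Const c \<in> carrier (poly_ring n)"
  by (simp add: poly_ring_def Const_def)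

lemma Var_in_carrier [simp]: "k < n \<Longrightarrow> Var k \<in> carrier (poly_ring n)"
  by (simp add: poly_ring_def Var_def)

lemma lin_form_in_carrier [simp]: "lin_form n c \<in> carrier (poly_ring n)"
  unfolding lin_form_def
  by (intro unital_subring_sum[OF unital_subring_carrier] unital_subringD[OF unital_subring_carrier]) auto

lemma carrier_subset_subring:
  fixes R :: "'a::comm_ring_1 mpoly set"
  assumes R: "unital_subring R" and "\<And>c. Const c \<in> R" and "\<And>k. k < n \<Longrightarrow> Var k \<in> R"
  shows "carrier (poly_ring n) \<subseteq> R"
proof
  fix p :: "'a mpoly" assume p: "p \<in> carrier (poly_ring n)"
  have "Const (Poly_Mapping.lookup p m) * monom_value Var m \<in> R" if "m \<in> Poly_Mapping.keys p" for m
    using that p assms(2,3) unfolding monom_value_def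
    by (intro unital_subringD[OF R] unital_subring_prod[OF R] unital_subring_power[OF R])
      (auto simp: poly_ring_def)
  then have "(\<Sum>m\<in>Poly_Mapping.keys p. Const (Poly_Mapping.lookup p m) * monom_value Var m) \<in> R"
    by (rule unital_subring_sum[OF R])
  also have "(\<Sum>m\<in>Poly_Mapping.keys p. Const (Poly_Mapping.lookup p m) * monom_value Var m) = p"
    by (simp add: monom_value_Var Const_def mult_single poly_mapping_sum_single)
  finally show "p \<in> R" .
qed

lemma unital_subring_invariants: "unital_subring (invariants n G)"
  unfolding unital_subring_def invariants_def
  using unital_subringD[OF unital_subring_carrier[of n]] by (auto simp: act_minus act_mult)

lemma Const_in_invariants [simp]: "Const c \<in> invariants n G"
  by (simp add: invariants_def)

section \<open>Homogeneous components\<close>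

lemma mon_deg_superset:
  assumes "finite A" "Poly_Mapping.keys m \<subseteq> A"
  shows "mon_deg m = (\<Sum>k\<in>A. Poly_Mapping.lookup m k)"
  unfolding mon_deg_def
  by (rule sum.mono_neutral_left) (use assms in \<open>auto simp: in_keys_iff\<close>)

lemma mon_deg_add: "mon_deg (m + m') = mon_deg m + mon_deg m'"
  using Poly_Mapping.keys_add[of m m']
  by (simp add: mon_deg_superset[of "Poly_Mapping.keys m \<union> Poly_Mapping.keys m'"] lookup_add sum.distrib)

lemma mon_deg_eq_0_iff [simp]: "mon_deg m = 0 \<longleftrightarrow> m = 0"
proof
  assume "mon_deg m = 0"
  then have "Poly_Mapping.lookup m k = 0" for k
    by (cases "k \<in> Poly_Mapping.keys m") (auto simp: mon_deg_def in_keys_iff)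
  then show "m = 0" by (intro poly_mapping_eqI) auto
qed (simp add: mon_deg_def)

lemma mon_deg_single [simp]: "mon_deg (Poly_Mapping.single k e) = e"
  by (simp add: mon_deg_def)

lemma homogeneous_0 [simp]: "homogeneous d 0"
  by (simp add: homogeneous_def)

lemma homogeneous_add: "homogeneous d p \<Longrightarrow> homogeneous d r \<Longrightarrow> homogeneous d (p + r)"
  using Poly_Mapping.keys_add[of p r] by (auto simp: homogeneous_def)

lemma homogeneous_sum: "(\<And>x. x \<in> A \<Longrightarrow> homogeneous d (f x)) \<Longrightarrow> homogeneous d (sum f A)"
  by (induction A rule: infinite_finite_induct) (auto simp: homogeneous_add)

lemma homogeneous_mult:
  "homogeneous d p \<Longrightarrow> homogeneous e r \<Longrightarrow> homogeneous (d + e) (p * r :: 'a::comm_ring_1 mpoly)"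
  using Poly_Mapping.keys_mult[of p r] by (fastforce simp: homogeneous_def mon_deg_add)

lemma homogeneous_1: "homogeneous 0 (1 :: 'a::comm_ring_1 mpoly)"
  by (simp add: homogeneous_def)

lemma homogeneous_Const: "homogeneous 0 (Const c :: 'a::comm_ring_1 mpoly)"
  by (simp add: homogeneous_def Const_def)

lemma homogeneous_power:
  "homogeneous d p \<Longrightarrow> homogeneous (k * d) (p ^ k :: 'a::comm_ring_1 mpoly)"
  by (induction k) (auto intro: homogeneous_1 homogeneous_mult)

lemma homogeneous_prod:
  "(\<And>x. x \<in> A \<Longrightarrow> homogeneous (d x) (f x)) \<Longrightarrow>
    homogeneous (sum d A) (prod f A :: 'a::comm_ring_1 mpoly)"
  by (induction A rule: infinite_finite_induct) (auto simp: homogeneous_1 homogeneous_mult)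

lemma homogeneous_lin_form: "homogeneous 1 (lin_form n c)"
  unfolding lin_form_def
proof (rule homogeneous_sum)
  fix i
  have "homogeneous 1 (Var i :: 'a mpoly)" by (simp add: homogeneous_def Var_def)
  from homogeneous_mult[OF homogeneous_Const this] show "homogeneous 1 (Const (c i) * Var i)" by simp
qed

lemma homogeneous_act:
  fixes p :: "'a::comm_ring_1 mpoly"
  assumes "homogeneous d p"
  shows "homogeneous d (act n g p)"
proof -
  have "homogeneous (mon_deg m) (monom_value (\<lambda>k. lin_form n (\<lambda>i. g $$ (i, k))) m)" for m
    unfolding monom_value_def mon_deg_def
    using homogeneous_power[OF homogeneous_lin_form] by (intro homogeneous_prod) auto
  from homogeneous_mult[OF homogeneous_Const this] assms show ?thesis
    unfolding act_superset[OF finite_keys subset_refl]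
    by (intro homogeneous_sum) (auto simp: homogeneous_def)
qed

definition hom_comp :: "nat \<Rightarrow> 'a::comm_ring_1 mpoly \<Rightarrow> 'a mpoly" where
  "hom_comp d p = (\<Sum>m | m \<in> Poly_Mapping.keys p \<and> mon_deg m = d.
     Poly_Mapping.single m (Poly_Mapping.lookup p m))"

lemma lookup_hom_comp:
  "Poly_Mapping.lookup (hom_comp d p) m = (if mon_deg m = d then Poly_Mapping.lookup p m else 0)"
  by (auto simp: hom_comp_def lookup_sum lookup_single when_def in_keys_iff)

lemma homogeneous_hom_comp: "homogeneous d (hom_comp d p)"
  by (auto simp: homogeneous_def in_keys_iff lookup_hom_comp split: if_splits)

lemma hom_comp_sum: "hom_comp d (sum f A) = (\<Sum>x\<in>A. hom_comp d (f x))"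
  by (intro poly_mapping_eqI) (simp add: lookup_hom_comp lookup_sum)

lemma hom_comp_homogeneous:
  "homogeneous e p \<Longrightarrow> hom_comp d p = (if e = d then p else 0)"
  by (intro poly_mapping_eqI) (auto simp: lookup_hom_comp homogeneous_def in_keys_iff)

lemma sum_hom_comp: "(\<Sum>d\<in>mon_deg ` Poly_Mapping.keys p. hom_comp d p) = p"
  by (intro poly_mapping_eqI) (auto simp: lookup_hom_comp lookup_sum image_iff in_keys_iff)

text \<open>Variables go to linear forms, so the substitution preserves degrees. Consequently the
  homogeneous components of an invariant are invariant.\<close>

lemma hom_comp_act: "hom_comp d (act n g p) = act n g (hom_comp d p)"
proof -
  let ?D = "mon_deg ` Poly_Mapping.keys p"
  have "hom_comp d (act n g p) = (\<Sum>e\<in>?D. hom_comp d (act n g (hom_comp e p)))"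
    by (subst sum_hom_comp[of p, symmetric]) (simp only: act_sum hom_comp_sum)
  also have "\<dots> = (\<Sum>e\<in>?D. if e = d then act n g (hom_comp d p) else 0)"
    by (intro sum.cong refl)
      (simp add: hom_comp_homogeneous[OF homogeneous_act[OF homogeneous_hom_comp]])
  also have "\<dots> = act n g (hom_comp d p)"
  proof (cases "d \<in> ?D")
    case False
    then have "hom_comp d p = 0"
      by (intro poly_mapping_eqI) (auto simp: lookup_hom_comp image_iff in_keys_iff)
    then show ?thesis by simp
  qed simp
  finally show ?thesis .
qed

lemma hom_comp_invariants:
  assumes "p \<in> invariants n G"
  shows "hom_comp d p \<in> invariants n G"
proof -
  have "Poly_Mapping.keys (hom_comp d p) \<subseteq> Poly_Mapping.keys p"
    by (auto simp: in_keys_iff lookup_hom_comp split: if_splits)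
  then show ?thesis
    using assms by (auto simp: invariants_def poly_ring_def hom_comp_act[symmetric])
qed

text \<open>The generators of the ideal are homogeneous, but the coefficients met below are not.
  Without constant term, every nonzero homogeneous component has positive degree and is itself a
  generator.\<close>

lemma invariant_in_coinv_ideal:
  fixes p :: "'a::comm_ring_1 mpoly"
  assumes p: "p \<in> invariants n G" and "Poly_Mapping.lookup p 0 = 0"
  shows "p \<in> coinv_ideal n G"
proof -
  interpret P: cring "poly_ring n :: 'a mpoly ring" by (rule cring_poly_ring)
  interpret J: ideal "coinv_ideal n G" "poly_ring n :: 'a mpoly ring" by (rule ideal_coinv_ideal)
  have "{p \<in> invariants n G. \<exists>d>0. homogeneous d p} \<subseteq> (coinv_ideal n G :: 'a mpoly set)"
    unfolding coinv_ideal_def by (rule P.genideal_self) (auto simp: invariants_def)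
  moreover have "d > 0" if "d \<in> mon_deg ` Poly_Mapping.keys p" for d
  proof (rule ccontr)
    assume "\<not> d > 0"
    with that have "0 \<in> Poly_Mapping.keys p" by auto
    then show False using assms(2) by (simp add: in_keys_iff)
  qed
  ultimately have *: "hom_comp d p \<in> coinv_ideal n G" if "d \<in> mon_deg ` Poly_Mapping.keys p" for d
    using that hom_comp_invariants[OF p] homogeneous_hom_comp by blast
  have "sum f A \<in> coinv_ideal n G" if "\<And>x. x \<in> A \<Longrightarrow> f x \<in> coinv_ideal n G"
    for f :: "nat \<Rightarrow> 'a mpoly" and A
    using that J.zero_closed J.a_closed
    by (induction A rule: infinite_finite_induct) auto
  from this[of "mon_deg ` Poly_Mapping.keys p" "\<lambda>d. hom_comp d p"] *
  show ?thesis by (simp add: sum_hom_comp)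
qed

section \<open>Independence of homomorphisms\<close>

text \<open>Artin's argument: the relation at \<open>y * x\<close> minus \<open>\<phi> j y\<close>
  times the relation at \<open>x\<close> no longer contains the index \<open>j\<close>, and the
  factors \<open>\<phi> i y - \<phi> j y\<close> cancel in a domain. \<open>M\<close> is only a
  submonoid, since the relation will be known on the polynomials in the \<open>n\<close> variables
  and not on the whole type.\<close>

lemma dedekind_independence:
  fixes \<phi> :: "'i \<Rightarrow> 'm::monoid_mult \<Rightarrow> 'r::idom"
  assumes "finite A"
    and M: "1 \<in> M" "\<And>x y. x \<in> M \<Longrightarrow> y \<in> M \<Longrightarrow> x * y \<in> M"
    and hom: "\<And>i. i \<in> A \<Longrightarrow> \<phi> i 1 = 1"
      "\<And>i x y. i \<in> A \<Longrightarrow> x \<in> M \<Longrightarrow> y \<in> M \<Longrightarrow> \<phi> i (x * y) = \<phi> i x * \<phi> i y"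
    and dist: "\<And>i j. i \<in> A \<Longrightarrow> j \<in> A \<Longrightarrow> i \<noteq> j \<Longrightarrow> \<exists>x\<in>M. \<phi> i x \<noteq> \<phi> j x"
    and zero: "\<And>x. x \<in> M \<Longrightarrow> (\<Sum>i\<in>A. a i * \<phi> i x) = 0"
  shows "\<forall>i\<in>A. a i = 0"
  using assms(1) hom dist zero
proof (induction A arbitrary: a rule: finite_induct)
  case (insert j A)
  have A: "a i = 0" if i: "i \<in> A" for i
  proof -
    obtain y where y: "y \<in> M" "\<phi> i y \<noteq> \<phi> j y"
      using insert.prems(3)[of i j] i insert.hyps by auto
    have "(\<Sum>i\<in>A. (a i * (\<phi> i y - \<phi> j y)) * \<phi> i x) = 0" if x: "x \<in> M" for x
    proof -
      have 1: "a j * \<phi> j y * \<phi> j x + (\<Sum>i\<in>A. a i * \<phi> i y * \<phi> i x) = 0"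
        using insert.prems(4)[OF M(2)[OF y(1) x]] insert.hyps insert.prems(2) x y
        by (simp add: mult.assoc)
      have 2: "\<phi> j y * (a j * \<phi> j x + (\<Sum>i\<in>A. a i * \<phi> i x)) = 0"
        using insert.prems(4)[OF x] insert.hyps by simp
      have "(\<Sum>i\<in>A. (a i * (\<phi> i y - \<phi> j y)) * \<phi> i x) =
          (\<Sum>i\<in>A. a i * \<phi> i y * \<phi> i x) - \<phi> j y * (\<Sum>i\<in>A. a i * \<phi> i x)"
        by (simp add: sum_distrib_left sum_subtractf[symmetric] algebra_simps)
      also have "\<dots> = (a j * \<phi> j y * \<phi> j x + (\<Sum>i\<in>A. a i * \<phi> i y * \<phi> i x)) -
          \<phi> j y * (a j * \<phi> j x + (\<Sum>i\<in>A. a i * \<phi> i x))" by (simp add: algebra_simps)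
      finally show ?thesis by (simp only: 1 2) simp
    qed
    from insert.IH[OF _ _ _ this] insert.prems have "a i * (\<phi> i y - \<phi> j y) = 0"
      using i by auto
    then show ?thesis using y by simp
  qed
  moreover have "a j = 0"
    using insert.prems(4)[OF M(1)] insert.prems(1) insert.hyps A by simp
  ultimately show ?case by simp
qed simp

lemma mult_mat_vec_eq_0_iff:
  assumes "A \<in> carrier_mat N N" "v \<in> carrier_vec N"
  shows "A *\<^sub>v v = 0\<^sub>v N \<longleftrightarrow> (\<forall>i<N. (\<Sum>j<N. A $$ (i, j) * v $ j) = (0 :: 'r::comm_ring_1))"
  using assms by (auto simp: vec_eq_iff scalar_prod_def atLeast0LessThan)

text \<open>A generating family of at most as many elements as there are homomorphisms is free: the square
  matrix of the values of the homomorphisms has independent rows by Dedekind's lemma, so a relation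
  between its columns is trivial.\<close>

lemma free_if_enough_homs:
  fixes \<phi> :: "nat \<Rightarrow> 'r::idom \<Rightarrow> 'r" and b :: "nat \<Rightarrow> 'r"
  assumes P: "unital_subring P"
    and hom: "\<And>i. i < N \<Longrightarrow> comm_ring_hom (\<phi> i)"
    and fixed: "\<And>i s. i < N \<Longrightarrow> s \<in> S \<Longrightarrow> \<phi> i s = s"
    and dist: "\<And>i j. i < N \<Longrightarrow> j < N \<Longrightarrow> i \<noteq> j \<Longrightarrow> \<exists>x\<in>P. \<phi> i x \<noteq> \<phi> j x"
    and gen: "\<And>x. x \<in> P \<Longrightarrow> \<exists>s. (\<forall>j<N. s j \<in> S) \<and> x = (\<Sum>j<N. s j * b j)"
    and rel: "\<And>j. j < N \<Longrightarrow> s j \<in> S" "(\<Sum>j<N. s j * b j) = 0"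
    and j: "j < N"
  shows "s j = 0"
proof (rule ccontr)
  assume s: "s j \<noteq> 0"
  have eval: "\<phi> i (\<Sum>j<N. s j * b j) = (\<Sum>j<N. s j * \<phi> i (b j))"
    if "i < N" "\<And>j. j < N \<Longrightarrow> s j \<in> S" for i and s :: "nat \<Rightarrow> 'r"
  proof -
    interpret comm_ring_hom "\<phi> i" by (rule hom[OF that(1)])
    show ?thesis using that fixed by (simp add: hom_sum hom_mult)
  qed
  define A where "A = mat N N (\<lambda>(i, j). \<phi> i (b j))"
  have A: "A \<in> carrier_mat N N" by (simp add: A_def)
  have "A *\<^sub>v vec N s = 0\<^sub>v N"
  proof (subst mult_mat_vec_eq_0_iff[OF A])
    show "\<forall>i<N. (\<Sum>j<N. A $$ (i, j) * vec N s $ j) = 0"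
    proof (intro allI impI)
      fix i assume i: "i < N"
      interpret comm_ring_hom "\<phi> i" by (rule hom[OF i])
      have "(\<Sum>j<N. s j * \<phi> i (b j)) = 0" using eval[OF i, of s] rel by simp
      then show "(\<Sum>j<N. A $$ (i, j) * vec N s $ j) = 0" using i by (simp add: A_def mult.commute)
    qed
  qed simp
  moreover have "vec N s \<noteq> 0\<^sub>v N" using s j by (auto simp: vec_eq_iff)
  ultimately have "det A = 0" using det_0_iff_vec_prod_zero[OF A] by (metis vec_carrier)
  \<comment> \<open>A dependence between the columns yields one between the rows. With its
    coefficients \<open>a\<close>, the combination of the homomorphisms vanishes on each
    \<open>b j\<close> and, as they all fix \<open>S\<close>, on everything that the
    \<open>b j\<close> generate over \<open>S\<close>, in particular on \<open>P\<close>.\<close>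
  then have "det (transpose_mat A) = 0" by (simp add: det_transpose[OF A])
  moreover have T: "transpose_mat A \<in> carrier_mat N N" using A by simp
  ultimately obtain a where a: "a \<in> carrier_vec N" "a \<noteq> 0\<^sub>v N" "transpose_mat A *\<^sub>v a = 0\<^sub>v N"
    using det_0_iff_vec_prod_zero by blast
  have 0: "(\<Sum>i<N. \<phi> i (b j) * a $ i) = 0" if "j < N" for j
    using a(3) that unfolding mult_mat_vec_eq_0_iff[OF T a(1)] by (simp add: A_def)
  have "\<forall>i\<in>{..<N}. a $ i = 0"
  proof (rule dedekind_independence[where M = P and \<phi> = \<phi>])
    fix x assume "x \<in> P"
    then obtain s where s: "\<And>j. j < N \<Longrightarrow> s j \<in> S" "x = (\<Sum>j<N. s j * b j)" using gen by blast
    have "(\<Sum>i<N. a $ i * \<phi> i x) = (\<Sum>i<N. \<Sum>j<N. s j * (\<phi> i (b j) * a $ i))"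
      using eval[of _ s] s by (intro sum.cong refl) (simp add: sum_distrib_left algebra_simps)
    also have "\<dots> = (\<Sum>j<N. s j * (\<Sum>i<N. \<phi> i (b j) * a $ i))"
      by (subst sum.swap) (simp add: sum_distrib_left)
    finally show "(\<Sum>i<N. a $ i * \<phi> i x) = 0" by (simp add: 0)
  next
    fix i assume "i \<in> {..<N}"
    then interpret comm_ring_hom "\<phi> i" by (intro hom) auto
    show "\<phi> i 1 = 1" "\<phi> i (x * y) = \<phi> i x * \<phi> i y" for x y by (auto simp: hom_mult)
  qed (use unital_subringD[OF P] dist in auto)
  then show False using a by (auto simp: vec_eq_iff)
qed

section \<open>Adjoining the variables one by one\<close>

definition bounded_exps :: "nat set \<Rightarrow> (nat \<Rightarrow> nat) \<Rightarrow> (nat \<Rightarrow>\<^sub>0 nat) set" where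
  "bounded_exps A b = {m. Poly_Mapping.keys m \<subseteq> A \<and> (\<forall>k\<in>A. Poly_Mapping.lookup m k < b k)}"

lemma bij_betw_bounded_exps:
  assumes "finite A"
  shows "bij_betw (\<lambda>m. restrict (Poly_Mapping.lookup m) A) (bounded_exps A b) (PiE A (\<lambda>k. {..<b k}))"
proof (rule bij_betw_byWitness[where f' = "\<lambda>f. Abs_poly_mapping (\<lambda>k. if k \<in> A then f k else 0)"])
  have fin: "finite {k. (if k \<in> A then f k else 0) \<noteq> (0::nat)}" for f
    by (rule finite_subset[OF _ assms]) (auto split: if_splits)
  note [simp] = lookup_Abs_poly_mapping[OF fin]
  show "\<forall>m\<in>bounded_exps A b.
      Abs_poly_mapping (\<lambda>k. if k \<in> A then restrict (Poly_Mapping.lookup m) A k else 0) = m"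
  proof
    fix m assume m: "m \<in> bounded_exps A b"
    have "(\<lambda>k. if k \<in> A then restrict (Poly_Mapping.lookup m) A k else 0) = Poly_Mapping.lookup m"
      using m by (auto simp: bounded_exps_def fun_eq_iff in_keys_iff subset_iff)
    then show "Abs_poly_mapping (\<lambda>k. if k \<in> A then restrict (Poly_Mapping.lookup m) A k else 0) = m"
      by (simp add: lookup_inverse)
  qed
  show "\<forall>f\<in>PiE A (\<lambda>k. {..<b k}).
      restrict (Poly_Mapping.lookup (Abs_poly_mapping (\<lambda>k. if k \<in> A then f k else 0))) A = f"
    by (auto simp: fun_eq_iff PiE_def extensional_def)
  show "(\<lambda>m. restrict (Poly_Mapping.lookup m) A) ` bounded_exps A b \<subseteq> PiE A (\<lambda>k. {..<b k})"
    by (auto simp: bounded_exps_def)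
  show "(\<lambda>f. Abs_poly_mapping (\<lambda>k. if k \<in> A then f k else 0)) ` PiE A (\<lambda>k. {..<b k}) \<subseteq> bounded_exps A b"
    by (auto simp: bounded_exps_def in_keys_iff split: if_splits)
qed

lemma
  assumes "finite A"
  shows finite_bounded_exps: "finite (bounded_exps A b)"
    and card_bounded_exps: "card (bounded_exps A b) = (\<Prod>k\<in>A. b k)"
  using bij_betw_finite[OF bij_betw_bounded_exps[OF assms]]
    bij_betw_same_card[OF bij_betw_bounded_exps[OF assms]] assms
  by (auto simp: finite_PiE card_PiE)

text \<open>\<open>S\<close> is an arbitrary set because it will stand both for the invariants and
  for the invariants without constant term, and the latter do not contain 1.\<close>

definition monom_span :: "'a::comm_ring_1 mpoly set \<Rightarrow> (nat \<Rightarrow>\<^sub>0 nat) set \<Rightarrow> 'a mpoly set" where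
  "monom_span S E = {\<Sum>m\<in>E. f m * Poly_Mapping.single m 1 | f. \<forall>m\<in>E. f m \<in> S}"

lemma monom_span_sum:
  assumes S: "\<And>f. (\<And>i. i \<in> A \<Longrightarrow> f i \<in> S) \<Longrightarrow> sum f A \<in> S"
    and "\<And>i. i \<in> A \<Longrightarrow> p i \<in> monom_span S E"
  shows "sum p A \<in> monom_span S E"
proof -
  have "\<forall>i\<in>A. \<exists>f. p i = (\<Sum>m\<in>E. f m * Poly_Mapping.single m 1) \<and> (\<forall>m\<in>E. f m \<in> S)"
    using assms(2) by (fastforce simp: monom_span_def)
  then obtain f where f: "\<forall>i\<in>A. p i = (\<Sum>m\<in>E. f i m * Poly_Mapping.single m 1) \<and> (\<forall>m\<in>E. f i m \<in> S)"
    by metis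
  then have "sum p A = (\<Sum>m\<in>E. (\<Sum>i\<in>A. f i m) * Poly_Mapping.single m 1)"
    by (simp add: sum_distrib_right) (rule sum.swap)
  moreover have "(\<Sum>i\<in>A. f i m) \<in> S" if "m \<in> E" for m
    using f that by (intro S) auto
  ultimately show ?thesis
    unfolding monom_span_def by (intro CollectI exI[of _ "\<lambda>m. \<Sum>i\<in>A. f i m"]) auto
qed

lemma monom_span_single:
  assumes "0 \<in> S" "s \<in> S" "m \<in> E" "finite E"
  shows "s * Poly_Mapping.single m 1 \<in> monom_span S E"
proof -
  have "s * Poly_Mapping.single m 1 = (\<Sum>m'\<in>E. (if m' = m then s else 0) * Poly_Mapping.single m' 1)"
    using assms by (simp add: if_distrib[of "\<lambda>x. x * _"] cong: if_cong)
  then show ?thesis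
    unfolding monom_span_def using assms(1,2)
    by (intro CollectI exI[of _ "\<lambda>m'. if m' = m then s else 0"]) auto
qed

section \<open>Spans of variables and their root polynomials\<close>

text \<open>Both V_m and the span W of the treated variables have this shape. Demanding zero outside
  \<open>A\<close> makes the coefficient function of a form unique when \<open>A\<close> lies in
  \<open>{..<n}\<close>, which permits counting.\<close>

definition forms_on :: "nat \<Rightarrow> nat set \<Rightarrow> 'a::comm_ring_1 mpoly set" where
  "forms_on n A = lin_form n ` {c. \<forall>i. i \<notin> A \<longrightarrow> c i = 0}"

lemma
  assumes "finite A"
  shows finite_supported_funs: "finite {c :: nat \<Rightarrow> 'a::{finite,zero}. \<forall>i. i \<notin> A \<longrightarrow> c i = 0}"
    and card_supported_funs:
      "card {c :: nat \<Rightarrow> 'a::{finite,zero}. \<forall>i. i \<notin> A \<longrightarrow> c i = 0} = card (UNIV :: 'a set) ^ card A"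
proof -
  have "bij_betw (\<lambda>c. restrict c A) {c :: nat \<Rightarrow> 'a. \<forall>i. i \<notin> A \<longrightarrow> c i = 0} (PiE A (\<lambda>_. UNIV))"
    by (rule bij_betw_byWitness[where f' = "\<lambda>f k. if k \<in> A then f k else 0"])
      (auto simp: fun_eq_iff PiE_def extensional_def)
  from bij_betw_finite[OF this] bij_betw_same_card[OF this] assms
  show "finite {c :: nat \<Rightarrow> 'a. \<forall>i. i \<notin> A \<longrightarrow> c i = 0}"
    "card {c :: nat \<Rightarrow> 'a::{finite,zero}. \<forall>i. i \<notin> A \<longrightarrow> c i = 0} = card (UNIV :: 'a set) ^ card A"
    by (auto simp: finite_PiE card_PiE)
qed

lemma
  assumes "A \<subseteq> {..<n}"
  shows finite_forms_on: "finite (forms_on n A :: 'a::{finite,comm_ring_1} mpoly set)"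
    and card_forms_on:
      "card (forms_on n A :: 'a::{finite,comm_ring_1} mpoly set) = card (UNIV :: 'a set) ^ card A"
proof -
  have A: "finite A" using assms finite_subset by blast
  have "inj_on (lin_form n) {c :: nat \<Rightarrow> 'a. \<forall>i. i \<notin> A \<longrightarrow> c i = 0}"
    using assms by (intro inj_onI ext) (auto simp: lin_form_eq_iff subset_iff, metis)
  then show "card (forms_on n A :: 'a mpoly set) = card (UNIV :: 'a set) ^ card A"
    unfolding forms_on_def by (simp add: card_image card_supported_funs[OF A])
  show "finite (forms_on n A :: 'a::{finite,comm_ring_1} mpoly set)"
    unfolding forms_on_def by (intro finite_imageI finite_supported_funs A)
qed

lemma forms_on_mono: "A \<subseteq> B \<Longrightarrow> forms_on n A \<subseteq> forms_on n B"
  by (auto simp: forms_on_def)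

lemma Var_eq_lin_form:
  assumes "k < n"
  shows "Var k = lin_form n (\<lambda>i. if i = k then 1 else 0 :: 'a::comm_ring_1)"
proof -
  have "lin_form n (\<lambda>i. if i = k then 1 else 0 :: 'a) = (\<Sum>i<n. if i = k then Var k else 0)"
    unfolding lin_form_def by (intro sum.cong) auto
  then show ?thesis using assms by simp
qed

lemma Var_in_forms_on_iff:
  assumes "k < n"
  shows "(Var k :: 'a::comm_ring_1 mpoly) \<in> forms_on n A \<longleftrightarrow> k \<in> A"
proof
  assume "(Var k :: 'a mpoly) \<in> forms_on n A"
  then obtain c where c: "\<forall>i. i \<notin> A \<longrightarrow> c i = (0::'a)" "(Var k :: 'a mpoly) = lin_form n c"
    by (auto simp: forms_on_def)
  then have "c k = 1" using assms by (auto simp: Var_eq_lin_form lin_form_eq_iff)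
  then show "k \<in> A" using c by auto
qed (use assms in \<open>auto simp: forms_on_def Var_eq_lin_form\<close>)

lemma forms_on_subset_subring:
  fixes R :: "'a::comm_ring_1 mpoly set"
  assumes R: "unital_subring R" and "\<And>c. Const c \<in> R" and "\<And>k. k \<in> A \<Longrightarrow> Var k \<in> R"
  shows "forms_on n A \<subseteq> R"
proof
  fix p :: "'a mpoly" assume "p \<in> forms_on n A"
  then obtain c where c: "\<forall>i. i \<notin> A \<longrightarrow> c i = 0" "p = lin_form n c" by (auto simp: forms_on_def)
  have "Const (c i) * Var i \<in> R" for i
    using c assms(2,3) unital_subringD[OF R] by (cases "i \<in> A") auto
  then show "p \<in> R" unfolding c lin_form_def by (intro unital_subring_sum[OF R])
qed

text \<open>For the span of the first m variables over the field with q elements, the nonzero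
  coefficients below the leading one are, up to sign, the Dickson invariants of GL_m(q).\<close>

definition roots_poly :: "'a::comm_ring_1 set \<Rightarrow> 'a poly" where
  "roots_poly V = (\<Prod>v\<in>V. [:- v, 1:])"

lemma roots_poly_polys_over:
  "unital_subring R \<Longrightarrow> V \<subseteq> R \<Longrightarrow> roots_poly V \<in> polys_over R"
  unfolding roots_poly_def
  by (intro unital_subring_prod unital_subring_polys_over linear_polys_over) auto

lemma monic_roots_poly: "lead_coeff (roots_poly V :: 'a::idom poly) = 1"
  by (simp add: roots_poly_def lead_coeff_prod)

lemma degree_roots_poly: "degree (roots_poly V :: 'a::idom poly) = card V"
  unfolding roots_poly_def by (subst degree_prod_sum_eq) auto

lemma poly_roots_poly_eq_0: "finite V \<Longrightarrow> v \<in> V \<Longrightarrow> poly (roots_poly V :: 'a::idom poly) v = 0"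
  by (auto simp: roots_poly_def poly_prod)

text \<open>
  The index \<open>k\<close> lies in the block \<open>{lo k..<hi k}\<close>, and the variable with index \<open>mirror s\<close> is
  the one adjoined in step \<open>s\<close>.
\<close>

locale blocks =
  fixes n :: nat and lo hi :: "nat \<Rightarrow> nat"
  assumes bounds: "k < n \<Longrightarrow> lo k \<le> k \<and> k < hi k \<and> hi k \<le> n"
    and same_block: "k < n \<Longrightarrow> lo k \<le> j \<Longrightarrow> j < hi k \<Longrightarrow> lo j = lo k \<and> hi j = hi k"
begin

text \<open>The reversal of each block. As it is an involution, \<open>mirror k\<close> is also the
  step in which variable \<open>k\<close> is adjoined, hence the number of variables treated before
  it.\<close>

definition mirror :: "nat \<Rightarrow> nat" where
  "mirror k = lo k + hi k - 1 - k"

lemma mirror: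
  assumes "k < n"
  shows "lo k \<le> mirror k" "mirror k < hi k" "mirror k < n" "lo (mirror k) = lo k" "hi (mirror k) = hi k"
    "mirror (mirror k) = k"
proof -
  note b = bounds[OF assms]
  show 1: "lo k \<le> mirror k" "mirror k < hi k" "mirror k < n" using b by (auto simp: mirror_def)
  show 2: "lo (mirror k) = lo k" "hi (mirror k) = hi k" using same_block[OF assms 1(1,2)] by auto
  have "mirror (mirror k) = lo k + hi k - 1 - (lo k + hi k - 1 - k)"
    unfolding mirror_def[of "mirror k"] 2 by (simp add: mirror_def)
  then show "mirror (mirror k) = k" using b by auto
qed

lemma bij_mirror: "bij_betw mirror {..<n} {..<n}"
  by (rule bij_betw_byWitness[where f' = mirror]) (auto simp: mirror)

lemma hi_mono:
  assumes "j \<le> k" "k < n"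
  shows "hi j \<le> hi k"
proof (cases "k < hi j")
  case True
  then have "hi k = hi j" using same_block[of j k] bounds[of j] assms by auto
  then show ?thesis by simp
next
  case False
  then show ?thesis using bounds[of k] assms by auto
qed

text \<open>Reversal stays inside blocks, so the variables treated before step \<open>s\<close> do
  not reach beyond the block of \<open>s\<close>. This gives the inclusion of W in V_m.\<close>

lemma mirror_image_subset:
  assumes "s < n"
  shows "mirror ` {..<s} \<subseteq> {..<hi s}"
proof -
  have "mirror t < hi s" if "t < s" for t
    using mirror(2)[of t] hi_mono[of t s] that assms by auto
  then show ?thesis by auto
qed

lemma card_mirror_image: "s \<le> n \<Longrightarrow> card (mirror ` {..<s}) = s"
  using inj_on_subset[OF bij_betw_imp_inj_on[OF bij_mirror]] by (subst card_image) auto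

text \<open>One more than the exponent of variable \<open>k\<close> in the theorem. As
  \<open>mirror k\<close> counts the treated variables, it is the cardinality of V_m minus that of
  W.\<close>

definition bnd :: "nat \<Rightarrow> nat \<Rightarrow> nat" where
  "bnd q k = q ^ hi k - q ^ mirror k"

primrec tower :: "'a::comm_ring_1 mpoly set \<Rightarrow> nat \<Rightarrow> 'a mpoly set" where
  "tower S 0 = S"
| "tower S (Suc s) = adjoin (tower S s) (Var (mirror s))"

lemma tower_props:
  assumes S: "unital_subring S"
  shows "unital_subring (tower S s)" "S \<subseteq> tower S s" "t < s \<Longrightarrow> Var (mirror t) \<in> tower S s"
proof -
  show 1: "unital_subring (tower S s)" for s
    by (induction s) (auto intro: unital_subring_adjoin S)
  show "S \<subseteq> tower S s"
    by (induction s) (use subset_adjoin(1)[OF 1] in auto)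
  show "t < s \<Longrightarrow> Var (mirror t) \<in> tower S s"
    by (induction s) (use subset_adjoin[OF 1] in \<open>auto simp: less_Suc_eq\<close>)
qed

lemma tower_subset_monom_span:
  fixes S :: "'a::{finite,field} mpoly set"
  defines "q \<equiv> card (UNIV :: 'a set)"
  assumes S: "unital_subring S" and Const: "\<And>c. Const c \<in> S"
    and inv: "\<And>k. k < n \<Longrightarrow> roots_poly (forms_on n {..<hi k}) \<in> polys_over S"
    and s: "s \<le> n"
  shows "tower S s \<subseteq> monom_span S (bounded_exps (mirror ` {..<s}) (bnd q))"
  using s
proof (induction s)
  case 0
  have "bounded_exps {} (bnd q) = {0}" by (auto simp: bounded_exps_def)
  then show ?case using monom_span_single[OF unital_subringD(2)[OF S], of _ 0 "{0}"] by auto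
next
  case (Suc s)
  note T = tower_props[OF S, where s = s]
  let ?R = "tower S s"
  let ?k = "mirror s"
  let ?V = "forms_on n {..<hi s} :: 'a mpoly set"
  let ?W = "forms_on n (mirror ` {..<s}) :: 'a mpoly set"
  let ?E = "bounded_exps (mirror ` {..<s}) (bnd q)"
  let ?E' = "bounded_exps (mirror ` {..<Suc s}) (bnd q)"
  have s: "s < n" using Suc.prems by simp
  have hi: "{..<hi s} \<subseteq> {..<n}" using bounds[OF s] by auto
  have fin: "finite ?V" "finite ?W"
    using hi mirror_image_subset[OF s] by (auto intro!: finite_forms_on)
  have WV: "?W \<subseteq> ?V" by (intro forms_on_mono mirror_image_subset s)
  have WR: "?W \<subseteq> ?R" by (rule forms_on_subset_subring) (use T Const in auto)
  have split: "roots_poly ?V = roots_poly ?W * roots_poly (?V - ?W)"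
    unfolding roots_poly_def using prod.subset_diff[OF WV fin(1)] by (simp add: mult.commute)
  have "roots_poly ?V \<in> polys_over ?R" using inv[OF s] T(2) by (auto simp: polys_over_def)
  \<comment> \<open>The product has coefficients in \<open>?R\<close> by invariance, the divisor
    because its roots \<open>?W\<close> are already in \<open>?R\<close>; monic division does the
    rest.\<close>
  then have Q: "roots_poly (?V - ?W) \<in> polys_over ?R"
    using monic_quotient_polys_over[OF T(1) roots_poly_polys_over[OF T(1) WR] monic_roots_poly]
    by (simp add: split)
  have "mirror t \<noteq> mirror s" if "t < s" for t
    using that s mirror(6)[of t] mirror(6)[of s] by auto
  then have notin: "?k \<notin> mirror ` {..<s}" by (metis imageE lessThan_iff)
  then have root: "poly (roots_poly (?V - ?W)) (Var ?k) = 0"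
    using mirror(2,3)[OF s] fin notin
    by (intro poly_roots_poly_eq_0) (auto simp: Var_in_forms_on_iff[OF mirror(3)[OF s]])
  have deg: "degree (roots_poly (?V - ?W)) = bnd q ?k"
  proof -
    have "mirror ` {..<s} \<subseteq> {..<n}" by (rule order_trans[OF mirror_image_subset[OF s] hi])
    then have "card (?V - ?W) = q ^ hi s - q ^ s"
      using s unfolding card_Diff_subset[OF fin(2) WV] card_forms_on[OF hi] q_def
      by (subst card_forms_on) (auto simp: card_mirror_image)
    \<comment> \<open>The involution turns the count for step \<open>s\<close> into the bound
      attached to the variable \<open>?k\<close>, since \<open>mirror ?k = s\<close>.\<close>
    then show ?thesis by (simp only: degree_roots_poly bnd_def mirror(5,6)[OF s])
  qed
  have finE: "finite ?E'" by (rule finite_bounded_exps) auto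
  show ?case
  proof
    fix y assume "y \<in> tower S (Suc s)"
    then obtain r where r: "\<And>i. i < bnd q ?k \<Longrightarrow> r i \<in> ?R" "y = (\<Sum>i<bnd q ?k. r i * Var ?k ^ i)"
      using adjoin_root_monic[OF T(1) Q monic_roots_poly root, of y] by (auto simp: deg)
    have "r i * Var ?k ^ i \<in> monom_span S ?E'" if i: "i < bnd q ?k" for i
    proof -
      have "r i \<in> monom_span S ?E" using Suc r(1)[OF i] by auto
      then obtain f where f: "r i = (\<Sum>m\<in>?E. f m * Poly_Mapping.single m 1)" "\<forall>m\<in>?E. f m \<in> S"
        by (auto simp: monom_span_def)
      have pow: "(Var ?k :: 'a mpoly) ^ i = Poly_Mapping.single (Poly_Mapping.single ?k i) 1"
        using monom_value_Var[of "Poly_Mapping.single ?k i"] by (simp add: monom_value_single)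
      have "r i * Var ?k ^ i = (\<Sum>m\<in>?E. f m * Poly_Mapping.single (m + Poly_Mapping.single ?k i) 1)"
        by (simp add: f(1) pow sum_distrib_right mult.assoc mult_single)
      also have "\<dots> \<in> monom_span S ?E'"
      proof (intro monom_span_sum unital_subring_sum[OF S] monom_span_single unital_subringD(2)[OF S] finE)
        fix m assume m: "m \<in> ?E"
        show "f m \<in> S" using f m by auto
        \<comment> \<open>The new variable does not occur in the old monomials, so its exponent in
          the product is exactly \<open>i\<close>, below the bound.\<close>
        have "Poly_Mapping.lookup m ?k = 0"
          using m notin by (auto simp: bounded_exps_def in_keys_iff)
        then have "Poly_Mapping.lookup (m + Poly_Mapping.single ?k i) k < bnd q k"
          if "k \<in> mirror ` {..<Suc s}" for k
          using m i that by (cases "k = ?k")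
            (auto simp: bounded_exps_def lookup_add lookup_single lessThan_Suc)
        moreover have "Poly_Mapping.keys (m + Poly_Mapping.single ?k i) \<subseteq> mirror ` {..<Suc s}"
          using m by (intro order_trans[OF Poly_Mapping.keys_add])
            (auto simp: bounded_exps_def lessThan_Suc split: if_splits)
        ultimately show "m + Poly_Mapping.single ?k i \<in> ?E'" by (simp add: bounded_exps_def)
      qed
      finally show ?thesis .
    qed
    then show "y \<in> monom_span S ?E'" unfolding r(2) by (intro monom_span_sum unital_subring_sum[OF S]) auto
  qed
qed

lemma carrier_subset_monom_span:
  fixes S :: "'a::{finite,field} mpoly set"
  assumes S: "unital_subring S" and Const: "\<And>c. Const c \<in> S"
    and inv: "\<And>k. k < n \<Longrightarrow> roots_poly (forms_on n {..<hi k}) \<in> polys_over S"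
  shows "carrier (poly_ring n) \<subseteq> monom_span S (bounded_exps {..<n} (bnd (card (UNIV :: 'a set))))"
proof -
  have "Var k \<in> tower S n" if "k < n" for k
    using tower_props(3)[OF S, of "mirror k" n] mirror[OF that] by simp
  then have "carrier (poly_ring n) \<subseteq> tower S n"
    using tower_props[OF S, where s = n] Const by (intro carrier_subset_subring) auto
  also have "\<dots> \<subseteq> monom_span S (bounded_exps (mirror ` {..<n}) (bnd (card (UNIV :: 'a set))))"
    by (rule tower_subset_monom_span[OF assms]) auto
  also have "mirror ` {..<n} = {..<n}" using bij_mirror by (simp add: bij_betw_def)
  finally show ?thesis .
qed

end

section \<open>The ideal of the coinvariants\<close>

lemma act_lin_form_inj:
  fixes g :: "'a::field mat"
  assumes g: "g \<in> GL n" and eq: "act n g (lin_form n c) = act n g (lin_form n d)"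
  shows "lin_form n c = lin_form n d"
proof -
  have G: "g \<in> carrier_mat n n" and "invertible_mat g" using g by (auto simp: GL_def)
  then obtain h where h: "inverts_mat h g" "inverts_mat g h"
    using invertible_mat_def by blast
  \<comment> \<open>\<open>invertible_mat\<close> does not state the size of the inverse; it is read
    off from the two identity matrices.\<close>
  have "dim_col (h * g) = dim_row h" "dim_col (g * h) = dim_row g"
    using h by (simp_all add: inverts_mat_def)
  then have hc: "h \<in> carrier_mat n n" using G by auto
  then have hg: "h * g = 1\<^sub>m n" using h by (simp add: inverts_mat_def)
  have "g *\<^sub>v vec n c = g *\<^sub>v vec n d"
    using eq G by (auto simp: act_lin_form lin_form_eq_iff vec_eq_iff scalar_prod_def atLeast0LessThan)
  then have "(h * g) *\<^sub>v vec n c = (h * g) *\<^sub>v vec n d"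
    using hc G by (simp add: assoc_mult_mat_vec[of _ n n _ n])
  then show ?thesis by (simp add: hg lin_form_eq_iff vec_eq_iff)
qed

text \<open>Applied to the coefficients, \<open>g\<close> permutes the linear factors: an injective
  map of a finite set into itself is onto.\<close>

lemma roots_poly_invariant:
  fixes V :: "'a::field mpoly set"
  assumes V: "finite V" "V \<subseteq> carrier (poly_ring n)"
    and perm: "\<And>g. g \<in> G \<Longrightarrow> act n g ` V \<subseteq> V" "\<And>g. g \<in> G \<Longrightarrow> inj_on (act n g) V"
  shows "roots_poly V \<in> polys_over (invariants n G)"
proof -
  have "coeff (roots_poly V) i \<in> carrier (poly_ring n)" for i
    using roots_poly_polys_over[OF unital_subring_carrier V(2)] by (simp add: polys_over_def)
  moreover have "act n g (coeff (roots_poly V) i) = coeff (roots_poly V) i" if g: "g \<in> G" for g i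
  proof -
    interpret map_poly_comm_ring_hom "act n g"
      using comm_ring_hom_act by (rule map_poly_comm_ring_hom.intro)
    have "map_poly (act n g) (roots_poly V) = (\<Prod>v\<in>V. map_poly (act n g) [:- v, 1:])"
      unfolding roots_poly_def by (rule hom_prod)
    also have "\<dots> = (\<Prod>v\<in>V. [:- act n g v, 1:])"
      using act_minus[of n g 0] by (intro prod.cong refl) (simp add: map_poly_pCons)
    also have "\<dots> = roots_poly (act n g ` V)"
      unfolding roots_poly_def by (simp add: prod.reindex[OF perm(2)[OF g]])
    also have "act n g ` V = V"
      using V(1) perm[OF g] by (intro card_subset_eq) (auto simp: card_image)
    finally have "coeff (map_poly (act n g) (roots_poly V)) i = coeff (roots_poly V) i" by simp
    then show ?thesis by (simp add: coeff_map_poly)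
  qed
  ultimately show ?thesis by (simp add: polys_over_def invariants_def)
qed

text \<open>The zeros below row \<open>hi k\<close> in the columns before \<open>hi k\<close> say
  that \<open>g\<close> maps the span of the first \<open>hi k\<close> variables into
  itself.\<close>

lemma (in blocks) roots_poly_forms_invariant:
  fixes G :: "'a::{finite,field} mat set"
  assumes G: "G \<subseteq> GL n" and k: "k < n"
    and zero: "\<And>g r c. g \<in> G \<Longrightarrow> c < hi k \<Longrightarrow> hi k \<le> r \<Longrightarrow> r < n \<Longrightarrow> g $$ (r, c) = 0"
  shows "roots_poly (forms_on n {..<hi k}) \<in> polys_over (invariants n G)"
proof (rule roots_poly_invariant)
  have sub: "{..<hi k} \<subseteq> {..<n}" using bounds[OF k] by auto
  then show "finite (forms_on n {..<hi k} :: 'a mpoly set)" by (rule finite_forms_on)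
  show "(forms_on n {..<hi k} :: 'a mpoly set) \<subseteq> carrier (poly_ring n)"
    by (auto simp: forms_on_def)
  fix g assume g: "g \<in> G"
  show "inj_on (act n g) (forms_on n {..<hi k})"
    using act_lin_form_inj[of g n] g G by (auto simp: inj_on_def forms_on_def)
  show "act n g ` forms_on n {..<hi k} \<subseteq> forms_on n {..<hi k}"
  proof clarify
    fix p assume "p \<in> (forms_on n {..<hi k} :: 'a mpoly set)"
    then obtain c where c: "\<forall>i. i \<notin> {..<hi k} \<longrightarrow> c i = 0" "p = lin_form n c"
      by (auto simp: forms_on_def)
    \<comment> \<open>Cut off at \<open>hi k\<close> because \<open>forms_on\<close> requires zeros
      at all further indices, including those beyond the size of the matrix.\<close>
    define d where "d i = (if i < hi k then \<Sum>j<n. g $$ (i, j) * c j else 0)" for i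
    have "(\<Sum>j<n. g $$ (i, j) * c j) = d i" if "i < n" for i
    proof (cases "i < hi k")
      case False
      have "g $$ (i, j) * c j = 0" for j
        using c(1) zero[OF g, of j i] False that by (cases "j < hi k") auto
      then show ?thesis using False by (simp add: d_def)
    qed (simp add: d_def)
    then have "act n g p = lin_form n d" by (simp add: c act_lin_form lin_form_eq_iff)
    then show "act n g p \<in> forms_on n {..<hi k}" by (auto simp: forms_on_def d_def)
  qed
qed

section \<open>Freeness over the invariants\<close>

text \<open>Column \<open>k\<close> can be read off from the image of \<open>Var k\<close>. Thus
  different matrices give homomorphisms that differ on a variable, as Dedekind's lemma
  demands.\<close>

lemma act_eq_imp_eq:
  assumes "g \<in> carrier_mat n n" "h \<in> carrier_mat n n"
    and "\<And>k. k < n \<Longrightarrow> act n g (Var k) = act n h (Var k)"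
  shows "g = h"
proof (rule eq_matI)
  fix i j assume "i < dim_row h" "j < dim_col h"
  then have "i < n" "j < n" using assms by auto
  then show "g $$ (i, j) = h $$ (i, j)"
    using assms(3)[OF \<open>j < n\<close>] by (auto simp: act_Var lin_form_eq_iff)
qed (use assms in auto)

text \<open>The determinant argument needs a square matrix, so exactly \<open>card E\<close> members
  of \<open>G\<close> are selected and numbered along with the monomials.\<close>

lemma monom_span_free:
  fixes G :: "'a::field mat set"
  assumes E: "finite E" "\<And>m. m \<in> E \<Longrightarrow> Poly_Mapping.keys m \<subseteq> {..<n}"
    and gen: "carrier (poly_ring n) \<subseteq> monom_span (invariants n G) E"
    and G: "G \<subseteq> carrier_mat n n" "card E \<le> card G"
    and rel: "\<And>m. m \<in> E \<Longrightarrow> f m \<in> invariants n G" "(\<Sum>m\<in>E. f m * Poly_Mapping.single m 1) = 0"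
    and m: "m \<in> E"
  shows "f m = 0"
proof -
  let ?N = "card E"
  obtain T where T: "T \<subseteq> G" "card T = ?N" "finite T"
    using obtain_subset_with_card_n[OF G(2)] by blast
  obtain \<gamma> where \<gamma>: "bij_betw \<gamma> {0..<?N} T" using ex_bij_betw_nat_finite[OF T(3)] T(2) by metis
  obtain \<epsilon> where \<epsilon>: "bij_betw \<epsilon> {0..<?N} E" using ex_bij_betw_nat_finite[OF E(1)] by blast
  have sum_E: "(\<Sum>j<?N. F (\<epsilon> j)) = sum F E" for F :: "_ \<Rightarrow> 'a mpoly"
    using sum.reindex_bij_betw[OF \<epsilon>, of F] by (simp add: atLeast0LessThan)
  have "m \<in> \<epsilon> ` {0..<?N}" using m \<epsilon> by (simp add: bij_betw_def)
  then obtain j where j: "j < ?N" "m = \<epsilon> j" by auto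
  have \<epsilon>E: "\<epsilon> j \<in> E" if "j < ?N" for j using that \<epsilon> by (auto simp: bij_betw_def)
  have \<gamma>G: "\<gamma> i \<in> G" if "i < ?N" for i using that \<gamma> T(1) by (auto simp: bij_betw_def)
  have "f (\<epsilon> j) = 0"
  proof (rule free_if_enough_homs[where P = "carrier (poly_ring n)" and S = "invariants n G" and
        b = "\<lambda>j. Poly_Mapping.single (\<epsilon> j) 1" and \<phi> = "\<lambda>i. act n (\<gamma> i)" and s = "\<lambda>j. f (\<epsilon> j)"])
    show "unital_subring (carrier (poly_ring n :: 'a mpoly ring))" by (rule unital_subring_carrier)
    show "comm_ring_hom (act n (\<gamma> i))" for i by (rule comm_ring_hom_act)
    show "act n (\<gamma> i) s = s" if "i < ?N" "s \<in> invariants n G" for i s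
      using that \<gamma>G by (auto simp: invariants_def)
    show "\<exists>x\<in>carrier (poly_ring n). act n (\<gamma> i) x \<noteq> act n (\<gamma> j) x" if "i < ?N" "j < ?N" "i \<noteq> j" for i j
    proof -
      have "\<gamma> i \<noteq> \<gamma> j" using that \<gamma> by (auto simp: bij_betw_def inj_on_def)
      moreover have "\<gamma> i \<in> carrier_mat n n" "\<gamma> j \<in> carrier_mat n n" using G(1) \<gamma>G that by auto
      ultimately obtain k where "k < n" "act n (\<gamma> i) (Var k) \<noteq> act n (\<gamma> j) (Var k)"
        using act_eq_imp_eq by blast
      then show ?thesis by (intro bexI[of _ "Var k"]) auto
    qed
    show "\<exists>s. (\<forall>j<?N. s j \<in> invariants n G) \<and> x = (\<Sum>j<?N. s j * Poly_Mapping.single (\<epsilon> j) 1)"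
      if "x \<in> carrier (poly_ring n)" for x
    proof -
      from that gen obtain h where h: "x = (\<Sum>m\<in>E. h m * Poly_Mapping.single m 1)"
        "\<forall>m\<in>E. h m \<in> invariants n G" by (auto simp: monom_span_def)
      then show ?thesis
        using sum_E[of "\<lambda>m. h m * Poly_Mapping.single m 1"] \<epsilon>E by (intro exI[of _ "\<lambda>j. h (\<epsilon> j)"]) auto
    qed
    show "(\<Sum>j<?N. f (\<epsilon> j) * Poly_Mapping.single (\<epsilon> j) 1) = 0"
      using sum_E[of "\<lambda>m. f m * Poly_Mapping.single m 1"] rel(2) by simp
  qed (use rel(1) \<epsilon>E j in auto)
  then show ?thesis using j by simp
qed

section \<open>Coefficients without constant term\<close>

text \<open>The augmentation ideal of the invariant ring. Unlike the set of homogeneous generators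
  it is closed under sums, as a set of coefficients must be.\<close>

definition nonconst_invariants :: "nat \<Rightarrow> 'a::comm_ring_1 mat set \<Rightarrow> 'a mpoly set" where
  "nonconst_invariants n G = {p \<in> invariants n G. Poly_Mapping.lookup p 0 = 0}"

lemma nonconst_invariants_mult:
  assumes "p \<in> nonconst_invariants n G" "r \<in> invariants n G"
  shows "p * r \<in> nonconst_invariants n G"
proof -
  have "0 \<notin> Poly_Mapping.keys (p * r)"
  proof
    assume "0 \<in> Poly_Mapping.keys (p * r)"
    then obtain a b where ab: "0 = a + b" "a \<in> Poly_Mapping.keys p"
      using Poly_Mapping.keys_mult[of p r] by blast
    then have "mon_deg a = 0" using mon_deg_add[of a b] by (metis add_is_0 mon_deg_eq_0_iff)
    then show False using ab assms(1) by (simp add: nonconst_invariants_def in_keys_iff)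
  qed
  then show ?thesis
    using assms unital_subringD(4)[OF unital_subring_invariants]
    by (auto simp: nonconst_invariants_def in_keys_iff)
qed

lemma nonconst_invariants_sum:
  "(\<And>i. i \<in> A \<Longrightarrow> f i \<in> nonconst_invariants n G) \<Longrightarrow> sum f A \<in> nonconst_invariants n G"
  using unital_subring_sum[OF unital_subring_invariants, of A f n G]
  by (auto simp: nonconst_invariants_def lookup_sum)

lemma nonconst_invariants_0: "0 \<in> nonconst_invariants n G"
  using unital_subringD(2)[OF unital_subring_invariants] by (auto simp: nonconst_invariants_def)

lemma nonconst_mult_monom_span:
  assumes "u \<in> nonconst_invariants n G" "y \<in> monom_span (invariants n G) E"
  shows "u * y \<in> monom_span (nonconst_invariants n G) E"
proof -
  obtain f where f: "y = (\<Sum>m\<in>E. f m * Poly_Mapping.single m 1)" "\<forall>m\<in>E. f m \<in> invariants n G"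
    using assms(2) by (auto simp: monom_span_def)
  show ?thesis unfolding monom_span_def
    by (intro CollectI exI[of _ "\<lambda>m. u * f m"])
      (auto simp: f(1) sum_distrib_left mult.assoc intro!: nonconst_invariants_mult assms(1) f(2)[rule_format])
qed

text \<open>The right-hand side is an ideal containing the generators. For closure under
  multiplication by \<open>a\<close>, rewrite each \<open>a * x^m\<close> as a combination over the
  invariants; multiplying it by the coefficient of \<open>x^m\<close> keeps the constant terms
  zero.\<close>

lemma coinv_ideal_subset_monom_span:
  assumes E: "finite E" "\<And>m. m \<in> E \<Longrightarrow> Poly_Mapping.keys m \<subseteq> {..<n}"
    and gen: "carrier (poly_ring n) \<subseteq> monom_span (invariants n G) E"
  shows "coinv_ideal n G \<subseteq> (monom_span (nonconst_invariants n G) E :: 'a::field mpoly set)"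
proof -
  let ?P = "poly_ring n :: 'a mpoly ring"
  let ?M = "monom_span (nonconst_invariants n G) E"
  interpret P: cring ?P by (rule cring_poly_ring)
  note C = unital_subringD[OF unital_subring_carrier[of n]]
  have sub: "?M \<subseteq> carrier ?P"
  proof
    fix x assume "x \<in> ?M"
    then obtain f where f: "x = (\<Sum>m\<in>E. f m * Poly_Mapping.single m 1)"
      "\<forall>m\<in>E. f m \<in> nonconst_invariants n G" by (auto simp: monom_span_def)
    show "x \<in> carrier ?P" unfolding f
      by (intro unital_subring_sum[OF unital_subring_carrier] C)
        (use f E in \<open>auto simp: nonconst_invariants_def invariants_def poly_ring_def\<close>)
  qed
  have mult: "a * x \<in> ?M" if a: "a \<in> carrier ?P" and x: "x \<in> ?M" for a x
  proof -
    obtain f where f: "x = (\<Sum>m\<in>E. f m * Poly_Mapping.single m 1)"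
      "\<forall>m\<in>E. f m \<in> nonconst_invariants n G" using x by (auto simp: monom_span_def)
    have "a * Poly_Mapping.single m 1 \<in> monom_span (invariants n G) E" if "m \<in> E" for m
    proof -
      have "Poly_Mapping.single m 1 \<in> carrier ?P"
        using E(2)[OF that] by (simp add: poly_ring_def)
      from C(4)[OF a this] show ?thesis using gen by blast
    qed
    then have "(\<Sum>m\<in>E. f m * (a * Poly_Mapping.single m 1)) \<in> ?M"
      using f(2) by (intro monom_span_sum nonconst_invariants_sum nonconst_mult_monom_span) auto
    then show ?thesis by (simp add: f sum_distrib_left mult.left_commute)
  qed
  have add: "x + y \<in> ?M" if "x \<in> ?M" "y \<in> ?M" for x y
    using monom_span_sum[of "{True, False}" "nonconst_invariants n G" "\<lambda>b. if b then x else y" E] that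
      nonconst_invariants_sum[of "{True, False}" _ n G] by auto
  have "ideal ?M ?P"
  proof (rule idealI)
    show "ring ?P" ..
    show "subgroup ?M (add_monoid ?P)"
    proof
      show "?M \<subseteq> carrier (add_monoid ?P)" using sub by simp
      show "\<one>\<^bsub>add_monoid ?P\<^esub> \<in> ?M"
        using nonconst_invariants_0[of n G] by (auto simp: monom_span_def intro!: exI[of _ "\<lambda>_. 0"])
      show "x \<otimes>\<^bsub>add_monoid ?P\<^esub> y \<in> ?M" if "x \<in> ?M" "y \<in> ?M" for x y using add that by simp
      show "inv\<^bsub>add_monoid ?P\<^esub> x \<in> ?M" if "x \<in> ?M" for x
      proof -
        have "- x \<in> ?M" using mult[OF C(5)[OF C(1)] that] by simp
        moreover have "\<ominus>\<^bsub>?P\<^esub> x = - x"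
          using sub that \<open>- x \<in> ?M\<close> by (intro P.minus_equality) auto
        ultimately show ?thesis by (simp add: a_inv_def)
      qed
    qed
    show "x \<otimes>\<^bsub>?P\<^esub> a \<in> ?M" if "a \<in> ?M" "x \<in> carrier ?P" for a x
      using mult[OF that(2,1)] by simp
    show "a \<otimes>\<^bsub>?P\<^esub> x \<in> ?M" if "a \<in> ?M" "x \<in> carrier ?P" for a x
      using mult[OF that(2,1)] by (simp add: mult.commute[of a x])
  qed
  moreover have "{p \<in> invariants n G. \<exists>d>0. homogeneous d p} \<subseteq> ?M"
  proof clarify
    fix p :: "'a mpoly" and d :: nat assume p: "p \<in> invariants n G" "d > 0" "homogeneous d p"
    then have "0 \<notin> Poly_Mapping.keys p"
      using mon_deg_eq_0_iff[of 0] by (auto simp: homogeneous_def simp del: mon_deg_eq_0_iff)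
    then have "p \<in> nonconst_invariants n G"
      using p(1) by (simp add: nonconst_invariants_def in_keys_iff)
    \<comment> \<open>Uses \<open>p = p * 1\<close>, where 1 is itself a combination of the
      monomials over the invariants.\<close>
    from nonconst_mult_monom_span[OF this, of 1 E] show "p \<in> ?M" using gen C(1) by auto
  qed
  ultimately show ?thesis unfolding coinv_ideal_def by (rule P.genideal_minimal)
qed

text \<open>The differences \<open>Const (c m) - f m\<close> are the coefficients of a relation over
  the invariants, so freeness identifies each constant with an invariant that has no constant
  term.\<close>

lemma coinv_independent:
  fixes c :: "_ \<Rightarrow> 'a::field"
  assumes E: "finite E" "\<And>m. m \<in> E \<Longrightarrow> Poly_Mapping.keys m \<subseteq> {..<n}"
    and gen: "carrier (poly_ring n) \<subseteq> monom_span (invariants n G) E"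
    and G: "G \<subseteq> carrier_mat n n" "card E \<le> card G"
    and c: "(\<Sum>m\<in>E. Const (c m) * Poly_Mapping.single m 1) \<in> coinv_ideal n G"
    and m: "m \<in> E"
  shows "c m = 0"
proof -
  obtain f where f: "(\<Sum>m\<in>E. Const (c m) * Poly_Mapping.single m 1) = (\<Sum>m\<in>E. f m * Poly_Mapping.single m 1)"
      "\<forall>m\<in>E. f m \<in> nonconst_invariants n G"
    using c coinv_ideal_subset_monom_span[OF E gen] by (auto simp: monom_span_def)
  have "Const (c m) - f m = 0"
  proof (rule monom_span_free[OF E gen G _ _ m])
    show "Const (c m) - f m \<in> invariants n G" if "m \<in> E" for m
      using f that by (intro unital_subringD[OF unital_subring_invariants]) (auto simp: nonconst_invariants_def)
    show "(\<Sum>m\<in>E. (Const (c m) - f m) * Poly_Mapping.single m 1) = 0"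
      using f(1) by (simp add: left_diff_distrib sum_subtractf)
  qed
  then have "Poly_Mapping.lookup (Const (c m)) 0 = 0"
    using f(2) m by (auto simp: nonconst_invariants_def)
  then show ?thesis by (simp add: Const_def)
qed

text \<open>Modulo the ideal every invariant coefficient may be replaced by its constant
  term.\<close>

lemma coinv_spanning:
  fixes p :: "'a::field mpoly"
  assumes E: "finite E" "\<And>m. m \<in> E \<Longrightarrow> Poly_Mapping.keys m \<subseteq> {..<n}"
    and gen: "carrier (poly_ring n) \<subseteq> monom_span (invariants n G) E"
    and p: "p \<in> carrier (poly_ring n)"
  shows "\<exists>c. p - (\<Sum>m\<in>E. Const (c m) * Poly_Mapping.single m 1) \<in> coinv_ideal n G"
proof -
  interpret P: cring "poly_ring n :: 'a mpoly ring" by (rule cring_poly_ring)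
  interpret J: ideal "coinv_ideal n G" "poly_ring n :: 'a mpoly ring" by (rule ideal_coinv_ideal)
  obtain f where f: "p = (\<Sum>m\<in>E. f m * Poly_Mapping.single m 1)" "\<forall>m\<in>E. f m \<in> invariants n G"
    using p gen by (auto simp: monom_span_def)
  define c where "c m = Poly_Mapping.lookup (f m) 0" for m
  have "(f m - Const (c m)) * Poly_Mapping.single m 1 \<in> coinv_ideal n G" if m: "m \<in> E" for m
  proof -
    have "f m - Const (c m) \<in> invariants n G"
      using f(2) m by (intro unital_subringD[OF unital_subring_invariants]) auto
    then have "f m - Const (c m) \<in> coinv_ideal n G"
      by (rule invariant_in_coinv_ideal) (simp add: lookup_minus c_def Const_def)
    moreover have "Poly_Mapping.single m 1 \<in> carrier (poly_ring n :: 'a mpoly ring)"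
      using E(2)[OF m] by (simp add: poly_ring_def)
    ultimately show ?thesis using J.I_r_closed by fastforce
  qed
  moreover have "sum h E \<in> coinv_ideal n G" if "\<And>m. m \<in> E \<Longrightarrow> h m \<in> coinv_ideal n G"
    for h :: "_ \<Rightarrow> 'a mpoly"
    using E(1) that by (induction E rule: finite_induct) (use J.zero_closed J.a_closed in auto)
  ultimately have "(\<Sum>m\<in>E. (f m - Const (c m)) * Poly_Mapping.single m 1) \<in> coinv_ideal n G" by simp
  then show ?thesis by (intro exI[of _ c]) (simp add: f(1) left_diff_distrib sum_subtractf)
qed

section \<open>Passage to the quotient module\<close>

lemma coinv_proj_eq_iff:
  fixes p :: "'a::field mpoly"
  assumes "p \<in> carrier (poly_ring n)" "r \<in> carrier (poly_ring n)"
  shows "coinv_proj n G p = coinv_proj n G r \<longleftrightarrow> p - r \<in> coinv_ideal n G"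
proof -
  let ?J = "coinv_ideal n G :: 'a mpoly set"
  interpret P: cring "poly_ring n :: 'a mpoly ring" by (rule cring_poly_ring)
  interpret J: ideal ?J "poly_ring n :: 'a mpoly ring" by (rule ideal_coinv_ideal)
  have coset: "coinv_proj n G x = (\<lambda>j. j + x) ` ?J" for x
    by (auto simp: coinv_proj_def a_r_coset_def')
  have add: "x + y \<in> ?J" if "x \<in> ?J" "y \<in> ?J" for x y using J.a_closed that by simp
  have neg: "- x \<in> ?J" if "x \<in> ?J" for x
    using J.I_l_closed[OF that Const_in_carrier[of "- 1"]] by simp
  show ?thesis
  proof
    assume "coinv_proj n G p = coinv_proj n G r"
    moreover have "0 + p \<in> coinv_proj n G p" unfolding coset using J.zero_closed by (intro imageI) simp
    ultimately show "p - r \<in> ?J" by (auto simp: coset)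
  next
    assume d: "p - r \<in> ?J"
    have "j + p \<in> coinv_proj n G r" if "j \<in> ?J" for j
      unfolding coset using add[OF that d] by (intro image_eqI[of _ _ "j + (p - r)"]) auto
    moreover have "j + r \<in> coinv_proj n G p" if "j \<in> ?J" for j
      unfolding coset using add[OF that neg[OF d]] by (intro image_eqI[of _ _ "j + - (p - r)"]) auto
    ultimately show "coinv_proj n G p = coinv_proj n G r" by (auto simp: coset[of p] coset[of r])
  qed
qed

text \<open>Translates statements about sums of polynomials modulo the ideal into the vocabulary of
  vector spaces. Injectivity is independence applied to the difference of two monomials.\<close>

lemma coinv_basis:
  fixes G :: "'a::field mat set"
  assumes E: "finite E" "\<And>m. m \<in> E \<Longrightarrow> Poly_Mapping.keys m \<subseteq> {..<n}"
    and ind: "\<And>c m. (\<Sum>m\<in>E. Const (c m) * Poly_Mapping.single m 1) \<in> coinv_ideal n G \<Longrightarrow>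
      m \<in> E \<Longrightarrow> c m = 0"
    and span: "\<And>p. p \<in> carrier (poly_ring n) \<Longrightarrow>
      \<exists>c. p - (\<Sum>m\<in>E. Const (c m) * Poly_Mapping.single m 1) \<in> coinv_ideal n G"
  defines "B \<equiv> (\<lambda>m. Poly_Mapping.single m 1) ` E"
  shows "inj_on (coinv_proj n G) B" "vectorspace.basis class_ring (coinvariants n G) (coinv_proj n G ` B)"
proof -
  let ?P = "poly_ring n :: 'a mpoly ring"
  let ?J = "coinv_ideal n G"
  let ?Q = "?P Quot ?J"
  let ?V = "coinvariants n G"
  let ?h = "coinv_proj n G"
  let ?x = "\<lambda>m. Poly_Mapping.single m 1 :: 'a mpoly"
  let ?\<pi> = "\<lambda>m. ?h (?x m)"
  interpret P: cring ?P by (rule cring_poly_ring)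
  interpret J: ideal ?J ?P by (rule ideal_coinv_ideal)
  interpret h: ring_hom_ring ?P ?Q ?h
    using J.rcos_ring_hom_ring by (simp add: coinv_proj_def[abs_def])
  interpret V: vectorspace "class_ring :: 'a ring" ?V by (rule vectorspace_coinvariants)
  have V: "carrier ?V = carrier ?Q" "add ?V = add ?Q" "zero ?V = zero ?Q"
    "module.smult ?V = (\<lambda>c x. ?h (Const c) \<otimes>\<^bsub>?Q\<^esub> x)"
    by (simp_all add: coinvariants_def Let_def coinv_proj_def)
  note C = unital_subringD[OF unital_subring_carrier[of n, where 'a = 'a]]
  have xC: "?x m \<in> carrier ?P" if "m \<in> E" for m using E(2)[OF that] by (simp add: poly_ring_def)
  have combC: "(\<Sum>m\<in>A. Const (c m) * ?x m) \<in> carrier ?P" if "A \<subseteq> E" for A c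
    using that xC by (intro unital_subring_sum[OF unital_subring_carrier] C) auto
  have \<pi>C: "?\<pi> m \<in> carrier ?V" if "m \<in> E" for m using h.hom_closed[OF xC[OF that]] by (simp add: V)
  have inj: "inj_on ?\<pi> E"
  proof (rule inj_onI, rule ccontr)
    fix m m' assume m: "m \<in> E" "m' \<in> E" "?\<pi> m = ?\<pi> m'" "m \<noteq> m'"
    define c :: "_ \<Rightarrow> 'a" where "c = (\<lambda>k. if k = m then 1 else if k = m' then - 1 else 0)"
    have "(\<Sum>k\<in>E. Const (c k) * ?x k) = (\<Sum>k\<in>{m, m'}. Const (c k) * ?x k)"
      by (rule sum.mono_neutral_right) (use E m in \<open>auto simp: c_def\<close>)
    also have "\<dots> = ?x m - ?x m'" using m(4) by (simp add: c_def)
    also have "\<dots> \<in> ?J" using m coinv_proj_eq_iff[OF xC xC] by blast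
    finally have "c m = 0" using m(1) by (rule ind)
    then show False by (simp add: c_def)
  qed
  then show "inj_on ?h B" by (auto simp: B_def inj_on_def)
  have smult: "c \<odot>\<^bsub>?V\<^esub> ?h p = ?h (Const c * p)" if "p \<in> carrier ?P" for c p
    using h.hom_mult[OF Const_in_carrier that] by (simp add: V)
  have finsum: "finsum ?V (\<lambda>m. ?h (f m)) A = ?h (sum f A)"
    if "finite A" "\<And>m. m \<in> A \<Longrightarrow> f m \<in> carrier ?P" for f :: "(nat \<Rightarrow>\<^sub>0 nat) \<Rightarrow> 'a mpoly" and A
    using that
  proof (induction A rule: finite_induct)
    case empty
    then show ?case using h.hom_zero by (simp add: V)
  next
    case (insert a A)
    have "finsum ?V (\<lambda>m. ?h (f m)) (insert a A) = ?h (f a) \<oplus>\<^bsub>?V\<^esub> finsum ?V (\<lambda>m. ?h (f m)) A"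
      using insert h.hom_closed by (intro V.M.finsum_insert) (auto simp: V)
    also have "\<dots> = ?h (f a) \<oplus>\<^bsub>?Q\<^esub> ?h (sum f A)" using insert by (simp add: V)
    also have "\<dots> = ?h (f a + sum f A)"
      using h.hom_add[of "f a" "sum f A"] insert unital_subring_sum[OF unital_subring_carrier, of A f n]
      by auto
    finally show ?case using insert by simp
  qed
  have lincomb: "V.lincomb a (?\<pi> ` A) = ?h (\<Sum>m\<in>A. Const (a (?\<pi> m)) * ?x m)" if A: "A \<subseteq> E" for a A
  proof -
    have "V.lincomb a (?\<pi> ` A) = finsum ?V (\<lambda>m. a (?\<pi> m) \<odot>\<^bsub>?V\<^esub> ?\<pi> m) A"
      unfolding V.lincomb_def
      using A inj inj_on_subset \<pi>C by (intro V.M.finsum_reindex) (auto intro!: V.smult_closed)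
    also have "\<dots> = finsum ?V (\<lambda>m. ?h (Const (a (?\<pi> m)) * ?x m)) A"
      using A \<pi>C smult[OF xC] by (intro V.M.finsum_cong') (auto intro!: V.smult_closed simp flip: smult[OF xC])
    also have "\<dots> = ?h (\<Sum>m\<in>A. Const (a (?\<pi> m)) * ?x m)"
      using A xC finite_subset[OF A E(1)] C(4) by (intro finsum) auto
    finally show ?thesis .
  qed
  have B: "?h ` B = ?\<pi> ` E" by (simp add: B_def image_image)
  have BC: "?\<pi> ` E \<subseteq> carrier ?V" using \<pi>C by auto
  have zero: "zero ?V = ?h 0" using h.hom_zero by (simp add: V)
  have "\<not> V.lin_dep (?\<pi> ` E)"
  proof
    assume "V.lin_dep (?\<pi> ` E)"
    then obtain A a v where A: "finite A" "A \<subseteq> ?\<pi> ` E" "V.lincomb a A = zero ?V" "v \<in> A" "a v \<noteq> 0"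
      unfolding V.lin_dep_def by auto
    obtain E' where E': "E' \<subseteq> E" "A = ?\<pi> ` E'" using A(2) by (auto simp: subset_image_iff)
    obtain m where m: "m \<in> E'" "v = ?\<pi> m" using A(4) E' by auto
    \<comment> \<open>Extension by zero, since \<open>ind\<close> speaks of sums over all of
      \<open>E\<close>.\<close>
    define c where "c m = (if m \<in> E' then a (?\<pi> m) else 0)" for m
    have "(\<Sum>m\<in>E. Const (c m) * ?x m) = (\<Sum>m\<in>E'. Const (a (?\<pi> m)) * ?x m)"
      using E E' by (intro sum.mono_neutral_cong_right) (auto simp: c_def)
    also have "\<dots> \<in> ?J"
      using A(3) coinv_proj_eq_iff[OF combC[OF E'(1)] C(2)] by (auto simp: E'(2) lincomb[OF E'(1)] zero)
    finally have "c m = 0" using E' m by (intro ind) auto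
    then show False using m A(5) by (simp add: c_def)
  qed
  moreover have "V.span (?\<pi> ` E) = carrier ?V"
  proof
    show "V.span (?\<pi> ` E) \<subseteq> carrier ?V" by (rule V.span_is_subset2[OF BC])
    show "carrier ?V \<subseteq> V.span (?\<pi> ` E)"
    proof
      fix x assume "x \<in> carrier ?V"
      then obtain p where p: "p \<in> carrier ?P" "x = ?h p"
        by (auto simp: V FactRing_def A_RCOSETS_def' coinv_proj_def)
      obtain c where "p - (\<Sum>m\<in>E. Const (c m) * ?x m) \<in> ?J" using span[OF p(1)] by blast
      then have "x = ?h (\<Sum>m\<in>E. Const (c m) * ?x m)"
        using coinv_proj_eq_iff[OF p(1) combC[OF subset_refl]] p(2) by blast
      \<comment> \<open>\<open>lincomb\<close> takes coefficients indexed by cosets, so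
        \<open>c\<close> is pulled back along the inverse of the injective projection.\<close>
      also have "\<dots> = V.lincomb (\<lambda>v. c (the_inv_into E ?\<pi> v)) (?\<pi> ` E)"
        by (simp add: lincomb[OF subset_refl] the_inv_into_f_f[OF inj])
      finally show "x \<in> V.span (?\<pi> ` E)" unfolding V.span_def using E(1) by fastforce
    qed
  qed
  ultimately show "vectorspace.basis class_ring ?V (?h ` B)"
    unfolding V.basis_def B using BC by simp
qed

section \<open>Counting parabolic matrices\<close>

text \<open>If the matrix were singular, take the last nonzero entry of a kernel vector: the
  corresponding column would be a combination of the earlier ones.\<close>

lemma GL_if_columns_independent:
  fixes A :: "'a::field mat"
  assumes A: "A \<in> carrier_mat N N"
    and ind: "\<And>k d. k < N \<Longrightarrow> \<exists>r<N. A $$ (r, k) \<noteq> (\<Sum>c<k. d c * A $$ (r, c))"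
  shows "A \<in> GL N"
proof -
  have "det A \<noteq> 0"
  proof
    assume "det A = 0"
    then obtain v where v: "v \<in> carrier_vec N" "v \<noteq> 0\<^sub>v N" "A *\<^sub>v v = 0\<^sub>v N"
      using det_0_iff_vec_prod_zero[OF A] by blast
    define K where "K = {c. c < N \<and> v $ c \<noteq> 0}"
    have K: "finite K" "K \<noteq> {}" using v(1,2) by (auto simp: K_def vec_eq_iff)
    define k where "k = Max K"
    have k: "k < N" "v $ k \<noteq> 0" using Max_in[OF K] by (auto simp: k_def K_def)
    have beyond: "v $ c = 0" if "k < c" "c < N" for c
      using Max_ge[OF K(1), of c] that unfolding k_def[symmetric] by (auto simp: K_def)
    have "A $$ (r, k) = (\<Sum>c<k. (- v $ c / v $ k) * A $$ (r, c))" if r: "r < N" for r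
    proof -
      have "0 = (\<Sum>c<N. A $$ (r, c) * v $ c)"
        using v(3) r unfolding mult_mat_vec_eq_0_iff[OF A v(1)] by simp
      also have "\<dots> = (\<Sum>c<Suc k. A $$ (r, c) * v $ c)"
        using k beyond by (intro sum.mono_neutral_right) (auto simp: not_less Suc_le_eq)
      finally have "A $$ (r, k) * v $ k = - (\<Sum>c<k. A $$ (r, c) * v $ c)"
        by (simp add: add_eq_0_iff)
      moreover have "A $$ (r, k) = A $$ (r, k) * v $ k / v $ k" using k by simp
      ultimately have "A $$ (r, k) = - (\<Sum>c<k. A $$ (r, c) * v $ c) / v $ k" by simp
      also have "\<dots> = (\<Sum>c<k. (- v $ c / v $ k) * A $$ (r, c))"
        by (simp add: sum_divide_distrib sum_negf[symmetric] mult.commute)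
      finally show ?thesis .
    qed
    then show False using ind[OF k(1), of "\<lambda>c. - v $ c / v $ k"] by blast
  qed
  from det_non_zero_imp_unit[OF A this] obtain B
    where "B \<in> carrier_mat N N" "B * A = 1\<^sub>m N" "A * B = 1\<^sub>m N"
    by (auto simp: Units_def ring_mat_def)
  then show ?thesis
    using A by (auto simp: GL_def invertible_mat_def inverts_mat_def intro!: exI[of _ B])
qed

lemma finite_carrier_mat: "finite (carrier_mat m n :: 'a::finite mat set)"
proof (rule finite_subset)
  show "carrier_mat m n \<subseteq> mat m n ` PiE ({..<m} \<times> {..<n}) (\<lambda>_. UNIV :: 'a set)"
  proof
    fix A :: "'a mat" assume "A \<in> carrier_mat m n"
    then have "A = mat m n (restrict (\<lambda>ij. A $$ ij) ({..<m} \<times> {..<n}))" by (intro eq_matI) auto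
    moreover have "restrict (\<lambda>ij. A $$ ij) ({..<m} \<times> {..<n}) \<in> PiE ({..<m} \<times> {..<n}) (\<lambda>_. UNIV)"
      by auto
    ultimately show "A \<in> mat m n ` PiE ({..<m} \<times> {..<n}) (\<lambda>_. UNIV)" by (metis imageI)
  qed
qed (auto intro!: finite_PiE)

context blocks
begin

text \<open>
  A further column for a matrix with columns \<open>L\<close>: its restriction to the rows of its diagonal block
  is independent of the earlier columns of the same block.
\<close>

definition col_choices :: "(nat \<Rightarrow> 'a::field) list \<Rightarrow> (nat \<Rightarrow> 'a) set" where
  "col_choices L = {f. (\<forall>r. r \<notin> {..<hi (length L)} \<longrightarrow> f r = 0) \<and>
     (\<nexists>d. \<forall>r\<in>{lo (length L)..<hi (length L)}. f r = (\<Sum>c=lo (length L)..<length L. d c * (L ! c) r))}"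

primrec col_lists :: "nat \<Rightarrow> (nat \<Rightarrow> 'a::field) list set" where
  "col_lists 0 = {[]}"
| "col_lists (Suc s) = (\<lambda>(L, f). L @ [f]) ` Sigma (col_lists s) col_choices"

text \<open>Counts the complement: inadmissible columns are covered by the image of a set with
  \<open>q ^ length L\<close> elements.\<close>

lemma card_col_choices:
  fixes L :: "(nat \<Rightarrow> 'a::{finite,field}) list"
  defines "q \<equiv> card (UNIV :: 'a set)"
  assumes L: "length L < n"
  shows "finite (col_choices L)"
    and "q ^ hi (length L) - q ^ length L \<le> card (col_choices L)"
proof -
  let ?k = "length L"
  define V where "V = {f :: nat \<Rightarrow> 'a. \<forall>r. r \<notin> {..<hi ?k} \<longrightarrow> f r = 0}"
  define U where "U = {c :: nat \<Rightarrow> 'a. \<forall>r. r \<notin> {..<?k} \<longrightarrow> c r = 0}"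
  \<comment> \<open>One function \<open>c\<close> on \<open>{..<?k}\<close> packs two kinds of data:
    the free entries above the block (indices below \<open>lo ?k\<close>) and the coefficients of a
    combination of the earlier columns of the block (the remaining indices).\<close>
  define F where "F c = (\<lambda>r. if r < lo ?k then c r
    else if r < hi ?k then \<Sum>j=lo ?k..<?k. c j * (L ! j) r else 0)" for c
  have V: "finite V" "card V = q ^ hi ?k"
    using finite_supported_funs[OF finite_lessThan] card_supported_funs[OF finite_lessThan, of "hi ?k"]
    by (simp_all add: V_def q_def)
  have U: "finite U" "card U = q ^ ?k"
    using finite_supported_funs[OF finite_lessThan] card_supported_funs[OF finite_lessThan, of ?k]
    by (simp_all add: U_def q_def)
  show fin: "finite (col_choices L)"
    by (rule finite_subset[OF _ V(1)]) (auto simp: col_choices_def V_def)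
  have "V - F ` U \<subseteq> col_choices L"
  proof
    fix f assume f: "f \<in> V - F ` U"
    have False if d: "\<forall>r\<in>{lo ?k..<hi ?k}. f r = (\<Sum>c=lo ?k..<?k. d c * (L ! c) r)" for d
    proof -
      define c where "c r = (if ?k \<le> r then 0 else if r < lo ?k then f r else d r)" for r
      have "f = F c"
      proof
        fix r
        have "(\<Sum>j=lo ?k..<?k. c j * (L ! j) r) = (\<Sum>j=lo ?k..<?k. d j * (L ! j) r)"
          by (intro sum.cong) (auto simp: c_def)
        then show "f r = F c r" using d f bounds[OF L] by (auto simp: F_def c_def V_def)
      qed
      moreover have "c \<in> U" by (simp add: U_def c_def)
      ultimately show ?thesis using f by blast
    qed
    then have "\<nexists>d. \<forall>r\<in>{lo ?k..<hi ?k}. f r = (\<Sum>c=lo ?k..<?k. d c * (L ! c) r)" by blast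
    then show "f \<in> col_choices L" using f unfolding col_choices_def V_def by simp
  qed
  have "card V - card (F ` U) \<le> card (V - F ` U)"
    using U by (intro diff_card_le_card_Diff) auto
  also have "\<dots> \<le> card (col_choices L)" by (rule card_mono) fact+
  finally show "q ^ hi ?k - q ^ ?k \<le> card (col_choices L)"
    using card_image_le[OF U(1), of F] V U by linarith
qed

lemma card_col_lists:
  assumes "s \<le> n"
  shows "finite (col_lists s :: (nat \<Rightarrow> 'a::{finite,field}) list set)"
    and "(\<Prod>k<s. card (UNIV :: 'a set) ^ hi k - card (UNIV :: 'a set) ^ k) \<le>
      card (col_lists s :: (nat \<Rightarrow> 'a) list set)"
proof -
  let ?q = "card (UNIV :: 'a set)"
  have len: "length L = s" if "L \<in> col_lists s" for L :: "(nat \<Rightarrow> 'a) list" and s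
    using that by (induction s arbitrary: L) auto
  have "finite (col_lists s :: (nat \<Rightarrow> 'a) list set) \<and>
      (\<Prod>k<s. ?q ^ hi k - ?q ^ k) \<le> card (col_lists s :: (nat \<Rightarrow> 'a) list set)"
    using assms
  proof (induction s)
    case (Suc s)
    let ?L = "col_lists s :: (nat \<Rightarrow> 'a) list set"
    have IH: "finite ?L" "(\<Prod>k<s. ?q ^ hi k - ?q ^ k) \<le> card ?L" using Suc by auto
    have fin: "finite (col_choices L)" and le: "?q ^ hi s - ?q ^ s \<le> card (col_choices L)"
      if "L \<in> ?L" for L
      using card_col_choices[of L] len[OF that] Suc.prems by auto
    have "(\<Prod>k<Suc s. ?q ^ hi k - ?q ^ k) \<le> card ?L * (?q ^ hi s - ?q ^ s)"
      using IH(2) by simp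
    also have "\<dots> \<le> (\<Sum>L\<in>?L. card (col_choices L))"
      using sum_bounded_below[of ?L "?q ^ hi s - ?q ^ s"] le by simp
    also have "\<dots> = card (Sigma ?L col_choices)" using IH(1) fin by simp
    also have "\<dots> = card (col_lists (Suc s) :: (nat \<Rightarrow> 'a) list set)"
      by (simp, subst card_image) (auto simp: inj_on_def)
    finally show ?case using IH(1) fin by auto
  qed simp
  then show "finite (col_lists s :: (nat \<Rightarrow> 'a) list set)"
    "(\<Prod>k<s. ?q ^ hi k - ?q ^ k) \<le> card (col_lists s :: (nat \<Rightarrow> 'a) list set)" by auto
qed

lemma col_lists_nth:
  assumes "L \<in> col_lists s"
  shows "length L = s \<and> (\<forall>k<s. (\<forall>r\<ge>hi k. (L ! k) r = 0) \<and>
    (\<nexists>d. \<forall>r\<in>{lo k..<hi k}. (L ! k) r = (\<Sum>c=lo k..<k. d c * (L ! c) r)))"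
  using assms
proof (induction s arbitrary: L)
  case (Suc s)
  then obtain M f where L: "L = M @ [f]" "M \<in> col_lists s" "f \<in> col_choices M" by auto
  note IH = Suc.IH[OF L(2)]
  show ?case
  proof (intro conjI allI impI)
    show "length L = Suc s" using IH L by simp
    fix k assume k: "k < Suc s"
    have M: "M ! c = L ! c" if "c < s" for c using that IH by (simp add: L(1) nth_append)
    have f: "L ! s = f" using IH by (simp add: L(1) nth_append)
    show "(L ! k) r = 0" if "hi k \<le> r" for r
      using k IH M[of k] f L(3) that by (cases "k = s") (auto simp: col_choices_def less_Suc_eq)
    have sums: "(\<Sum>c=lo k..<k. d c * (L ! c) r) = (\<Sum>c=lo k..<k. d c * (M ! c) r)" for d r
      using k by (intro sum.cong) (auto simp: M)
    show "\<nexists>d. \<forall>r\<in>{lo k..<hi k}. (L ! k) r = (\<Sum>c=lo k..<k. d c * (L ! c) r)"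
      unfolding sums
      using k IH M[of k] f L(3) by (cases "k = s") (auto simp: col_choices_def less_Suc_eq)
  qed
qed simp

definition mat_of_col_list :: "(nat \<Rightarrow> 'a) list \<Rightarrow> 'a mat" where
  "mat_of_col_list L = mat n n (\<lambda>(r, c). (L ! c) r)"

text \<open>Columns are functions on all natural numbers. What the matrix does not show is zero by
  the support condition, so the matrix determines the list.\<close>

lemma inj_mat_of_col_list: "inj_on mat_of_col_list (col_lists n :: (nat \<Rightarrow> 'a::field) list set)"
proof (rule inj_onI)
  fix L M :: "(nat \<Rightarrow> 'a) list"
  assume LM: "L \<in> col_lists n" "M \<in> col_lists n" and eq: "mat_of_col_list L = mat_of_col_list M"
  note L = col_lists_nth[OF LM(1)] and M = col_lists_nth[OF LM(2)]
  show "L = M"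
  proof (rule nth_equalityI)
    fix k assume "k < length L"
    then have k: "k < n" using L by simp
    show "L ! k = M ! k"
    proof
      fix r
      show "(L ! k) r = (M ! k) r"
      proof (cases "r < n")
        case True
        have "mat_of_col_list L $$ (r, k) = mat_of_col_list M $$ (r, k)" by (simp add: eq)
        then show ?thesis using True k by (simp add: mat_of_col_list_def)
      next
        case False
        then have "hi k \<le> r" using bounds[OF k] by simp
        then show ?thesis using k L M by simp
      qed
    qed
  qed (use L M in simp)
qed

lemma hi_le_lo:
  assumes "k < n" "c < lo k"
  shows "hi c \<le> lo k"
proof (rule ccontr)
  assume "\<not> hi c \<le> lo k"
  then have "lo (lo k) = lo c"
    using same_block[of c "lo k"] assms bounds[of k] bounds[of c] by auto
  moreover have "lo (lo k) = lo k" using same_block[of k "lo k"] bounds[of k] assms by auto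
  ultimately show False using assms bounds[of k] bounds[of c] by auto
qed

lemma mat_of_col_list_zero:
  assumes "L \<in> col_lists n" "c < n" "hi c \<le> r" "r < n"
  shows "mat_of_col_list L $$ (r, c) = 0"
  using assms col_lists_nth[OF assms(1)] by (simp add: mat_of_col_list_def)

lemma mat_of_col_list_block:
  assumes L: "L \<in> col_lists n" and k: "k < n"
  shows "\<exists>r\<in>{lo k..<hi k}. mat_of_col_list L $$ (r, k) \<noteq> (\<Sum>c=lo k..<k. d c * mat_of_col_list L $$ (r, c))"
proof (rule ccontr)
  assume *: "\<not> ?thesis"
  have "(L ! k) r = (\<Sum>c=lo k..<k. d c * (L ! c) r)" if r: "r \<in> {lo k..<hi k}" for r
  proof -
    have "(\<Sum>c=lo k..<k. d c * (L ! c) r) = (\<Sum>c=lo k..<k. d c * mat_of_col_list L $$ (r, c))"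
      using k r bounds[OF k] by (intro sum.cong) (auto simp: mat_of_col_list_def)
    then show ?thesis using * r k bounds[OF k] by (auto simp: mat_of_col_list_def)
  qed
  then show False using col_lists_nth[OF L] k by blast
qed

text \<open>On the rows of the block of \<open>k\<close>, the columns of earlier blocks vanish, so
  independence inside the block already gives independence of all earlier columns.\<close>

lemma mat_of_col_list_GL:
  assumes L: "L \<in> col_lists n"
  shows "mat_of_col_list L \<in> GL n"
proof (rule GL_if_columns_independent)
  let ?A = "mat_of_col_list L"
  show "?A \<in> carrier_mat n n" by (simp add: mat_of_col_list_def)
  fix k d assume k: "k < n"
  obtain r where r: "r \<in> {lo k..<hi k}" "?A $$ (r, k) \<noteq> (\<Sum>c=lo k..<k. d c * ?A $$ (r, c))"
    using mat_of_col_list_block[OF L k] by blast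
  have "?A $$ (r, c) = 0" if "c < lo k" for c
    using that r k bounds[OF k] hi_le_lo[OF k that] by (intro mat_of_col_list_zero[OF L]) auto
  then have "(\<Sum>c<k. d c * ?A $$ (r, c)) = (\<Sum>c=lo k..<k. d c * ?A $$ (r, c))"
    by (intro sum.mono_neutral_right) (auto simp: not_le)
  then show "\<exists>r<n. ?A $$ (r, k) \<noteq> (\<Sum>c<k. d c * ?A $$ (r, c))"
    using r bounds[OF k] by (intro exI[of _ r]) auto
qed

lemma mat_of_col_list_diag_block_GL:
  assumes L: "L \<in> col_lists n" and k: "k < n"
  shows "mat (hi k - lo k) (hi k - lo k) (\<lambda>(r, c). mat_of_col_list L $$ (lo k + r, lo k + c))
    \<in> GL (hi k - lo k)" (is "?B \<in> GL ?N")
proof (rule GL_if_columns_independent)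
  show "?B \<in> carrier_mat ?N ?N" by simp
  fix j d assume j: "j < ?N"
  let ?A = "mat_of_col_list L" and ?k = "lo k + j"
  have k': "?k < n" "lo ?k = lo k" "hi ?k = hi k"
    using bounds[OF k] same_block[OF k, of ?k] j by auto
  obtain r where r: "r \<in> {lo k..<hi k}"
    "?A $$ (r, ?k) \<noteq> (\<Sum>c=lo k..<?k. d (c - lo k) * ?A $$ (r, c))"
    using mat_of_col_list_block[OF L k'(1), of "\<lambda>c. d (c - lo k)"] by (auto simp: k')
  have "(\<Sum>c=lo k..<?k. d (c - lo k) * ?A $$ (r, c)) = (\<Sum>c<j. d c * ?A $$ (r, lo k + c))"
    by (rule sum.reindex_bij_witness[of _ "\<lambda>c. lo k + c" "\<lambda>c. c - lo k"]) auto
  also have "\<dots> = (\<Sum>c<j. d c * ?B $$ (r - lo k, c))"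
    using r(1) j by (intro sum.cong) auto
  finally show "\<exists>r<?N. ?B $$ (r, j) \<noteq> (\<Sum>c<j. d c * ?B $$ (r, c))"
    using r j by (intro exI[of _ "r - lo k"]) auto
qed

end

section \<open>Compositions\<close>

text \<open>The cofactor of a divisor may be any polynomial, but the key \<open>m\<close> of the
  product must be \<open>m'\<close> plus some key of the cofactor, which yields the comparison of
  exponents.\<close>

lemma monomial_factors_single:
  assumes "Poly_Mapping.keys m \<subseteq> {..<n}"
  shows "monomial_factors n (Poly_Mapping.single m 1 :: 'a::comm_ring_1 mpoly) =
    (\<lambda>m'. Poly_Mapping.single m' 1) ` {m'. Poly_Mapping.keys m' \<subseteq> {..<n} \<and>
      (\<forall>k. Poly_Mapping.lookup m' k \<le> Poly_Mapping.lookup m k)}"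
proof (intro equalityI subsetI)
  fix b :: "'a mpoly" assume "b \<in> monomial_factors n (Poly_Mapping.single m 1)"
  then obtain m' c where b: "b = Poly_Mapping.single m' 1" "Poly_Mapping.keys m' \<subseteq> {..<n}"
    and c: "(Poly_Mapping.single m 1 :: 'a mpoly) = b * c"
    by (auto simp: monomial_factors_def monomials_def factor_def)
  have "m \<in> Poly_Mapping.keys (b * c)" unfolding c[symmetric] by simp
  then obtain a where "m = m' + a" using Poly_Mapping.keys_mult[of b c] by (auto simp: b)
  then show "b \<in> (\<lambda>m'. Poly_Mapping.single m' 1) ` {m'. Poly_Mapping.keys m' \<subseteq> {..<n} \<and>
      (\<forall>k. Poly_Mapping.lookup m' k \<le> Poly_Mapping.lookup m k)}"
    using b by (auto simp: lookup_add)
next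
  fix b :: "'a mpoly" assume "b \<in> (\<lambda>m'. Poly_Mapping.single m' 1) ` {m'. Poly_Mapping.keys m' \<subseteq> {..<n} \<and>
      (\<forall>k. Poly_Mapping.lookup m' k \<le> Poly_Mapping.lookup m k)}"
  then obtain m' where m': "b = Poly_Mapping.single m' 1" "Poly_Mapping.keys m' \<subseteq> {..<n}"
    "\<And>k. Poly_Mapping.lookup m' k \<le> Poly_Mapping.lookup m k" by auto
  have "m = m' + (m - m')"
    by (intro poly_mapping_eqI) (use m'(3) in \<open>simp add: lookup_add lookup_minus\<close>)
  then have "(Poly_Mapping.single m 1 :: 'a mpoly) = b * Poly_Mapping.single (m - m') 1"
    by (simp add: m' mult_single)
  moreover have "Poly_Mapping.keys (m - m') \<subseteq> {..<n}"
    using assms by (auto simp: in_keys_iff lookup_minus subset_iff)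
  then have "Poly_Mapping.single (m - m') 1 \<in> carrier (poly_ring n :: 'a mpoly ring)"
    by (simp add: poly_ring_def)
  ultimately show "b \<in> monomial_factors n (Poly_Mapping.single m 1)"
    using m' by (auto simp: monomial_factors_def monomials_def factor_def)
qed

text \<open>Reduces the theorem to two facts about \<open>G\<close>: its zero pattern, which gives
  generation, and a lower bound for its order, which gives independence.\<close>

lemma (in blocks) generates_block_basis_if_card:
  fixes G :: "'a::{finite,field} mat set"
  defines "q \<equiv> card (UNIV :: 'a set)"
  assumes G: "G \<subseteq> GL n"
    and zero: "\<And>g k r c. g \<in> G \<Longrightarrow> k < n \<Longrightarrow> c < hi k \<Longrightarrow> hi k \<le> r \<Longrightarrow> r < n \<Longrightarrow> g $$ (r, c) = 0"
    and card: "(\<Prod>k<n. bnd q k) \<le> card G"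
  shows "generates_block_basis n G (\<Prod>k<n. Var k ^ (bnd q k - 1))"
proof -
  let ?E = "bounded_exps {..<n} (bnd q)"
  define m0 where "m0 = (\<Sum>k<n. Poly_Mapping.single k (bnd q k - 1))"
  have "card {0, 1 :: 'a} \<le> q" unfolding q_def by (intro card_mono) auto
  then have q: "1 < q" by simp
  \<comment> \<open>Positivity makes the truncated subtraction harmless: an exponent is at most
    \<open>bnd q k - 1\<close> exactly if it is less than \<open>bnd q k\<close>.\<close>
  have bnd_pos: "0 < bnd q k" if "k < n" for k
    using power_strict_increasing[OF mirror(2)[OF that] q] by (simp add: bnd_def)
  have lookup_m0: "Poly_Mapping.lookup m0 k = (if k < n then bnd q k - 1 else 0)" for k
    by (simp add: m0_def lookup_sum lookup_single when_def)
  have keys_m0: "Poly_Mapping.keys m0 \<subseteq> {..<n}"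
    by (auto simp: in_keys_iff lookup_m0 split: if_splits)
  have f: "(\<Prod>k<n. Var k ^ (bnd q k - 1)) = (Poly_Mapping.single m0 1 :: 'a mpoly)"
    unfolding monom_value_Var[symmetric] monom_value_superset[OF finite_lessThan keys_m0]
    by (intro prod.cong) (auto simp: lookup_m0)
  have "{m'. Poly_Mapping.keys m' \<subseteq> {..<n} \<and>
      (\<forall>k. Poly_Mapping.lookup m' k \<le> Poly_Mapping.lookup m0 k)} = ?E"
  proof -
    have "Poly_Mapping.lookup m k \<le> Poly_Mapping.lookup m0 k \<longleftrightarrow> (k < n \<longrightarrow> Poly_Mapping.lookup m k < bnd q k)"
      if "Poly_Mapping.keys m \<subseteq> {..<n}" for m k
    proof (cases "k < n")
      case True
      then show ?thesis using bnd_pos[OF True] by (auto simp: lookup_m0)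
    next
      case False
      then have "k \<notin> Poly_Mapping.keys m" using that by auto
      then show ?thesis using False by (simp add: lookup_m0 in_keys_iff)
    qed
    then show ?thesis by (auto simp: bounded_exps_def)
  qed
  then have factors: "monomial_factors n (Poly_Mapping.single m0 1 :: 'a mpoly) =
      (\<lambda>m. Poly_Mapping.single m 1) ` ?E"
    by (simp add: monomial_factors_single[OF keys_m0])
  have E: "finite ?E" "\<And>m. m \<in> ?E \<Longrightarrow> Poly_Mapping.keys m \<subseteq> {..<n}"
    by (auto simp: finite_bounded_exps) (auto simp: bounded_exps_def)
  have gen: "carrier (poly_ring n) \<subseteq> monom_span (invariants n G) ?E"
    unfolding q_def using G zero
    by (intro carrier_subset_monom_span unital_subring_invariants roots_poly_forms_invariant) auto
  have G': "G \<subseteq> carrier_mat n n" "card ?E \<le> card G"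
    using G card by (auto simp: GL_def card_bounded_exps)
  have ind: "c m = 0"
    if "(\<Sum>m\<in>?E. Const (c m) * Poly_Mapping.single m 1) \<in> coinv_ideal n G" "m \<in> ?E"
    for c :: "_ \<Rightarrow> 'a" and m
    by (rule coinv_independent[OF E gen G' that])
  have span: "\<exists>c. p - (\<Sum>m\<in>?E. Const (c m) * Poly_Mapping.single m 1) \<in> coinv_ideal n G"
    if "p \<in> carrier (poly_ring n)" for p
    by (rule coinv_spanning[OF E gen that])
  have "inj_on (coinv_proj n G) ((\<lambda>m. Poly_Mapping.single m 1) ` ?E)"
    by (rule coinv_basis(1); fact E ind span)
  moreover have "vectorspace.basis class_ring (coinvariants n G)
      (coinv_proj n G ` (\<lambda>m. Poly_Mapping.single m 1) ` ?E)"
    by (rule coinv_basis(2); fact E ind span)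
  moreover have "Poly_Mapping.single m0 1 \<in> (monomials n :: 'a mpoly set)"
    using keys_m0 by (auto simp: monomials_def)
  ultimately show ?thesis unfolding generates_block_basis_def f factors by blast
qed

section \<open>Block numbers from partial sums\<close>

lemma part_sum_0 [simp]: "part_sum I 0 = 0"
  by (simp add: part_sum_def)

lemma part_sum_Suc: "i < length I \<Longrightarrow> part_sum I (Suc i) = part_sum I i + I ! i"
  by (simp add: part_sum_def take_Suc_conv_app_nth)

lemma part_sum_ge_length: "length I \<le> i \<Longrightarrow> part_sum I i = sum_list I"
  by (simp add: part_sum_def)

lemma part_sum_mono:
  assumes "i \<le> j"
  shows "part_sum I i \<le> part_sum I j"
proof (rule lift_Suc_mono_le[OF _ assms])
  show "part_sum I i \<le> part_sum I (Suc i)" for i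
    by (cases "i < length I") (auto simp: part_sum_Suc part_sum_ge_length)
qed

lemma part_sum_le: "part_sum I i \<le> sum_list I"
  using part_sum_mono[of i "max i (length I)" I] by (simp add: part_sum_ge_length)

definition part_index :: "nat list \<Rightarrow> nat \<Rightarrow> nat" where
  "part_index I k = (LEAST i. k < part_sum I (Suc i))"

lemma part_index_eqI:
  assumes "part_sum I i \<le> k" "k < part_sum I (Suc i)"
  shows "part_index I k = i"
  unfolding part_index_def
proof (rule Least_equality)
  fix j assume "k < part_sum I (Suc j)"
  then show "i \<le> j" using part_sum_mono[of "Suc j" i I] assms(1) by (cases "i \<le> j") auto
qed fact

lemma part_index:
  assumes "k < sum_list I"
  shows "part_sum I (part_index I k) \<le> k" "k < part_sum I (Suc (part_index I k))"
    "part_index I k < length I"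
proof -
  have ex: "k < part_sum I (Suc (length I))" using assms by (simp add: part_sum_ge_length)
  show "k < part_sum I (Suc (part_index I k))" unfolding part_index_def using ex by (rule LeastI)
  show le: "part_sum I (part_index I k) \<le> k"
  proof (cases "part_index I k")
    case (Suc i)
    then have "\<not> k < part_sum I (Suc i)"
      unfolding part_index_def by (intro not_less_Least) simp
    then show ?thesis by (simp add: Suc)
  qed simp
  show "part_index I k < length I"
    using le assms part_sum_ge_length[of I "part_index I k"] by (cases "part_index I k < length I") auto
qed

lemma blocks_composition:
  "blocks (sum_list I) (\<lambda>k. part_sum I (part_index I k)) (\<lambda>k. part_sum I (Suc (part_index I k)))"
proof
  show "part_sum I (part_index I k) \<le> k \<and> k < part_sum I (Suc (part_index I k)) \<and>
      part_sum I (Suc (part_index I k)) \<le> sum_list I" if "k < sum_list I" for k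
    using part_index[OF that] part_sum_le by auto
  show "part_sum I (part_index I j) = part_sum I (part_index I k) \<and>
      part_sum I (Suc (part_index I j)) = part_sum I (Suc (part_index I k))"
    if "part_sum I (part_index I k) \<le> j" "j < part_sum I (Suc (part_index I k))" for j k
    using part_index_eqI[OF that] by simp
qed

lemma prod_lessThan_add: "(\<Prod>k<a + b. F k) = (\<Prod>k<a. F k) * (\<Prod>j<b. F (a + j :: nat) :: 'b::comm_monoid_mult)"
  by (induction b) (auto simp: mult.assoc)

lemma prod_over_blocks:
  assumes "m \<le> length I"
  shows "(\<Prod>k<part_sum I m. F k) =
    (\<Prod>i<m. \<Prod>j=1..I ! i. F (part_sum I i + j - 1) :: 'b::comm_monoid_mult)"
  using assms
  by (induction m) (auto simp: part_sum_Suc prod_lessThan_add prod.atLeast1_atMost_eq)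

theorem proposition6p4:
  fixes q n :: nat and I :: "nat list"
  assumes "q = card (UNIV :: 'a::{finite,field} set)"
    and "\<forall>k\<in>set I. 0 < k" and "sum_list I = n"
  shows "generates_block_basis n (GL_parabolic I :: 'a mat set)
    (\<Prod>i<length I. \<Prod>j=1..I ! i.
       Var (part_sum I i + j - 1) ^
         (q ^ part_sum I (i + 1) - q ^ (part_sum I (i + 1) - j) - 1))"
proof -
  define lo where "lo k = part_sum I (part_index I k)" for k
  define hi where "hi k = part_sum I (Suc (part_index I k))" for k
  interpret blocks n lo hi
    using blocks_composition[of I] assms(3) by (simp add: lo_def[abs_def] hi_def[abs_def])
  let ?G = "GL_parabolic I :: 'a mat set"
  have zero: "g $$ (r, c) = 0"
    if g: "g \<in> ?G" and "c < hi k" "hi k \<le> r" "r < n" for g r c k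
  proof -
    \<comment> \<open>A row at or below \<open>hi k\<close> exists, so the block of \<open>k\<close>
      is not the last one, and the zero condition at the start of the next block applies.\<close>
    have "Suc (part_index I k) < length I"
      using that part_sum_ge_length[of I "Suc (part_index I k)"] assms(3)
      by (cases "Suc (part_index I k) < length I") (auto simp: hi_def)
    then show ?thesis using that assms(3) by (auto simp: GL_parabolic_def hi_def)
  qed
  have "mat_of_col_list L \<in> ?G" if L: "L \<in> col_lists n" for L :: "(nat \<Rightarrow> 'a) list"
    unfolding GL_parabolic_def mem_Collect_eq assms(3)
  proof (intro conjI allI impI)
    show "mat_of_col_list L \<in> GL n" by (rule mat_of_col_list_GL[OF L])
    show "mat_of_col_list L $$ (r, c) = 0"
      if "r < n" "c < n" and rc: "c < part_sum I k \<and> part_sum I k \<le> r" for k r c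
    proof -
      \<comment> \<open>\<open>part_sum I k\<close> is a block boundary to the right of
        \<open>c\<close>, so the whole block of \<open>c\<close> ends there or earlier.\<close>
      have "hi c \<le> part_sum I k"
        using part_sum_mono[of "Suc (part_index I c)" k I] part_sum_mono[of k "part_index I c" I]
          part_index(1)[of c I] rc that assms(3) by (cases "part_index I c < k") (auto simp: hi_def)
      then show ?thesis using rc that by (intro mat_of_col_list_zero[OF L]) auto
    qed
    show "mat (I ! k) (I ! k) (\<lambda>(r, c). mat_of_col_list L $$ (part_sum I k + r, part_sum I k + c)) \<in>
      GL (I ! k)" if k: "k < length I" for k
    proof -
      let ?k = "part_sum I k"
      \<comment> \<open>Parts are positive, so block \<open>k\<close> contains its own starting
        index, from which \<open>lo\<close> and \<open>hi\<close> recover the block.\<close>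
      have "?k < part_sum I (Suc k)" using assms(2) k by (simp add: part_sum_Suc)
      then have "part_index I ?k = k" "?k < n"
        using part_index_eqI[of I k ?k] part_sum_le[of I "Suc k"] assms(3) by auto
      then have "lo ?k = ?k" "hi ?k - ?k = I ! k" using k by (auto simp: lo_def hi_def part_sum_Suc)
      then show ?thesis using mat_of_col_list_diag_block_GL[OF L \<open>?k < n\<close>] by simp
    qed
  qed
  then have sub: "mat_of_col_list ` (col_lists n :: (nat \<Rightarrow> 'a) list set) \<subseteq> ?G" by auto
  have "?G \<subseteq> carrier_mat n n" using assms(3) by (auto simp: GL_parabolic_def GL_def)
  then have "finite ?G" using finite_carrier_mat finite_subset by blast
  \<comment> \<open>Exponent bounds follow the reversed order and column counts the natural one;
    reindexing by \<open>mirror\<close> matches the two products.\<close>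
  have "(\<Prod>k<n. bnd q k) = (\<Prod>k<n. q ^ hi (mirror k) - q ^ mirror k)"
    by (intro prod.cong) (auto simp: bnd_def mirror)
  also have "\<dots> = (\<Prod>k<n. q ^ hi k - q ^ k)"
    by (rule prod.reindex_bij_betw[OF bij_mirror])
  also have "\<dots> \<le> card (col_lists n :: (nat \<Rightarrow> 'a) list set)"
    unfolding assms(1) by (rule card_col_lists) simp
  also have "\<dots> = card (mat_of_col_list ` (col_lists n :: (nat \<Rightarrow> 'a) list set))"
    by (simp add: card_image[OF inj_mat_of_col_list])
  also have "\<dots> \<le> card ?G" by (rule card_mono[OF \<open>finite ?G\<close> sub])
  finally have card: "(\<Prod>k<n. bnd q k) \<le> card ?G" .
  have "?G \<subseteq> GL n" using assms(3) by (auto simp: GL_parabolic_def)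
  from generates_block_basis_if_card[OF this] zero card
  have "generates_block_basis n ?G (\<Prod>k<n. Var k ^ (bnd q k - 1))"
    by (simp only: assms(1))
  also have "(\<Prod>k<n. Var k ^ (bnd q k - 1)) = (\<Prod>i<length I. \<Prod>j=1..I ! i.
      (Var (part_sum I i + j - 1) :: 'a mpoly) ^ (bnd q (part_sum I i + j - 1) - 1))"
    using prod_over_blocks[of "length I" I "\<lambda>k. (Var k :: 'a mpoly) ^ (bnd q k - 1)"] assms(3)
    by (simp add: part_sum_ge_length)
  also have "\<dots> = (\<Prod>i<length I. \<Prod>j=1..I ! i. Var (part_sum I i + j - 1) ^
      (q ^ part_sum I (i + 1) - q ^ (part_sum I (i + 1) - j) - 1))"
  proof (intro prod.cong refl)
    fix i j assume i: "i \<in> {..<length I}" and j: "j \<in> {1..I ! i}"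
    \<comment> \<open>With 1-based \<open>j\<close> the index is \<open>lo + j - 1\<close>, whose
      mirror image \<open>lo + hi - 1 - (lo + j - 1)\<close> equals \<open>hi - j\<close>.\<close>
    have "part_index I (part_sum I i + j - 1) = i"
      using i j by (intro part_index_eqI) (auto simp: part_sum_Suc)
    then have "bnd q (part_sum I i + j - 1) = q ^ part_sum I (i + 1) - q ^ (part_sum I (i + 1) - j)"
      using j by (simp add: bnd_def mirror_def lo_def hi_def)
    then show "(Var (part_sum I i + j - 1) :: 'a mpoly) ^ (bnd q (part_sum I i + j - 1) - 1) =
        Var (part_sum I i + j - 1) ^ (q ^ part_sum I (i + 1) - q ^ (part_sum I (i + 1) - j) - 1)"
      by simp
  qed
  finally show ?thesis .
qed

end
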